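(* Let $\mathcal{H}$ be a separable complex Hilbert space with inner product $\langle\cdot,\cdot\rangle$, and let $\mathbf{A}$ be a (possibly unbounded) semi-bounded self-adjoint operator in $\mathcal{H}$ with lower bound $m(\mathbf{A})\in\mathbb{R}$. Let $\gamma\in\mathbb{R}$ with $\gamma<m(\mathbf{A})$. For each $r\in\mathbb{N}$, the form $\mathfrak{t}_r$ defined by $$\operatorname{dom}(\mathfrak{t}_r)=\operatorname{dom}\big((\mathbf{A}-\gamma)^{r/2}\big),$$ $$\mathfrak{t}_r[f,g]=\big\langle(\mathbf{A}-\gamma)^{r/2}f,(\mathbf{A}-\gamma)^{r/2}g\big\rangle+\gamma\langle f,g\rangle\qquad\text{for } f,g\in\operatorname{dom}(\mathfrak{t}_r),$$ is closed and semi-bounded.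
   Context: All Hilbert spaces are assumed separable. A self-adjoint operator $\mathbf{A}$ in $\mathcal{H}$ is semi-bounded (bounded from below) if there is a constant $k\in\mathbb{R}$ with $\langle \mathbf{A}x,x\rangle\ge k\langle x,x\rangle$ for all $x\in\operatorname{dom}(\mathbf{A})$; its lower bound $m(\mathbf{A})$ is the largest such $k$. Here $\mathbf{A}-\gamma$ means $\mathbf{A}-\gamma I$, which is a positive self-adjoint operator since $\gamma<m(\mathbf{A})$, and $(\mathbf{A}-\gamma)^{r/2}$ is defined through the spectral theorem (functional calculus). $\mathbb{N}$ denotes the positive integers. A (sesquilinear, symmetric) form $\mathfrak{t}$ with domain a linear subspace $\operatorname{dom}(\mathfrak{t})\subset\mathcal{H}$ is semi-bounded if there is $c\in\mathbb{R}$ with $\mathfrak{t}[f,f]\ge c\,\langle f,f\rangle$ for all $f\in\operatorname{dom}(\mathfrak{t})$. A semi-bounded form $\mathfrak{t}$ is closed if, whenever $f_n\in\operatorname{dom}(\mathfrak{t})$, $f_n\to f$ in $\mathcal{H}$ and $\mathfrak{t}[f_n-f_m,f_n-f_m]\to0$ as $n,m\to\infty$, it follows that $f\in\operatorname{dom}(\mathfrak{t})$ and $\mathfrak{t}[f_n-f,f_n-f]\to0$; equivalently, for any $c'$ strictly less than some lower bound $c$ of $\mathfrak{t}$, the space $\operatorname{dom}(\mathfrak{t})$ with the inner product $\mathfrak{t}[f,g]-c'\langle f,g\rangle$ is a Hilbert space. *)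

theory Defs
  imports "HOL-Analysis.Analysis"
begin

section \<open>Complex Hilbert spaces\<close>

text \<open>
  A complex inner product space is a real inner product space (which supplies norm and topology)
  with a compatible complex scalar multiplication and a Hermitian form whose real part is the real
  inner product; positive definiteness of the latter gives that of the former. The complex inner
  product is linear in its \<^emph>\<open>first\<close> argument.
\<close>

class complex_inner = real_inner +
  fixes scaleC :: "complex \<Rightarrow> 'a \<Rightarrow> 'a"  (infixr "*\<^sub>C" 75)
    and cinner :: "'a \<Rightarrow> 'a \<Rightarrow> complex"
  assumes scaleC_add_right: "a *\<^sub>C (x + y) = a *\<^sub>C x + a *\<^sub>C y"
    and scaleC_add_left: "(a + b) *\<^sub>C x = a *\<^sub>C x + b *\<^sub>C x"
    and scaleC_scaleC: "a *\<^sub>C (b *\<^sub>C x) = (a * b) *\<^sub>C x"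
    and scaleC_of_real: "complex_of_real r *\<^sub>C x = r *\<^sub>R x"
    and cinner_commute: "cinner x y = cnj (cinner y x)"
    and cinner_add_left: "cinner (x + y) z = cinner x z + cinner y z"
    and cinner_scaleC_left: "cinner (a *\<^sub>C x) y = a * cinner x y"
    and Re_cinner: "Re (cinner x y) = inner x y"

class chilbert_space = complex_inner + complete_space

definition csubspace :: "'a::complex_inner set \<Rightarrow> bool" where
  "csubspace S \<longleftrightarrow>
     0 \<in> S \<and> (\<forall>x\<in>S. \<forall>y\<in>S. x + y \<in> S) \<and> (\<forall>a. \<forall>x\<in>S. a *\<^sub>C x \<in> S)"


section \<open>Unbounded operators\<close>

text \<open>
  Only the values of \<open>op_app T\<close> on \<open>op_dom T\<close> are meaningful, so operators are compared by
  \<open>op_eq\<close> and not by equality.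
\<close>

datatype 'a unbounded_op = Unbounded_Op (op_dom: "'a set") (op_app: "'a \<Rightarrow> 'a")

definition op_eq :: "'a unbounded_op \<Rightarrow> 'a unbounded_op \<Rightarrow> bool" where
  "op_eq S T \<longleftrightarrow> op_dom S = op_dom T \<and> (\<forall>x\<in>op_dom S. op_app S x = op_app T x)"

definition linear_op :: "'a::complex_inner unbounded_op \<Rightarrow> bool" where
  "linear_op T \<longleftrightarrow> csubspace (op_dom T) \<and>
     (\<forall>x\<in>op_dom T. \<forall>y\<in>op_dom T. op_app T (x + y) = op_app T x + op_app T y) \<and>
     (\<forall>a. \<forall>x\<in>op_dom T. op_app T (a *\<^sub>C x) = a *\<^sub>C op_app T x)"

definition densely_defined :: "'a::complex_inner unbounded_op \<Rightarrow> bool" where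
  "densely_defined T \<longleftrightarrow> closure (op_dom T) = UNIV"

definition op_adjoint :: "'a::complex_inner unbounded_op \<Rightarrow> 'a unbounded_op" where
  "op_adjoint T = Unbounded_Op
     {y. \<exists>z. \<forall>x\<in>op_dom T. cinner (op_app T x) y = cinner x z}
     (\<lambda>y. THE z. \<forall>x\<in>op_dom T. cinner (op_app T x) y = cinner x z)"

definition self_adjoint :: "'a::complex_inner unbounded_op \<Rightarrow> bool" where
  "self_adjoint T \<longleftrightarrow> linear_op T \<and> densely_defined T \<and> op_eq T (op_adjoint T)"

text \<open>
  Both sides of the inequality are real when \<open>T\<close> is symmetric, hence the real parts.
\<close>

definition op_bounded_below_by :: "'a::complex_inner unbounded_op \<Rightarrow> real \<Rightarrow> bool" where
  "op_bounded_below_by T k \<longleftrightarrow>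
     (\<forall>x\<in>op_dom T. Re (cinner (op_app T x) x) \<ge> k * Re (cinner x x))"

definition semibounded_op :: "'a::complex_inner unbounded_op \<Rightarrow> bool" where
  "semibounded_op T \<longleftrightarrow> (\<exists>k. op_bounded_below_by T k)"

definition op_lower_bound :: "'a::complex_inner unbounded_op \<Rightarrow> real" where
  "op_lower_bound T = (GREATEST k. op_bounded_below_by T k)"

definition op_shift :: "'a::complex_inner unbounded_op \<Rightarrow> real \<Rightarrow> 'a unbounded_op" where
  "op_shift T c = Unbounded_Op (op_dom T) (\<lambda>x. op_app T x - complex_of_real c *\<^sub>C x)"


section \<open>Spectral measures and functional calculus\<close>

definition orth_projection :: "('a::complex_inner \<Rightarrow> 'a) \<Rightarrow> bool" where
  "orth_projection P \<longleftrightarrow>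
     (\<forall>x y. P (x + y) = P x + P y) \<and> (\<forall>a x. P (a *\<^sub>C x) = a *\<^sub>C P x) \<and>
     (\<forall>x. P (P x) = P x) \<and> (\<forall>x y. cinner (P x) y = cinner x (P y))"

definition spectral_measure :: "(real set \<Rightarrow> 'a::complex_inner \<Rightarrow> 'a) \<Rightarrow> bool" where
  "spectral_measure E \<longleftrightarrow>
     (\<forall>B\<in>sets borel. orth_projection (E B)) \<and>
     (\<forall>x. E UNIV x = x) \<and>
     (\<forall>F x. range F \<subseteq> sets borel \<longrightarrow> disjoint_family F \<longrightarrow>
        (\<lambda>n::nat. E (F n) x) sums E (\<Union>n. F n) x)"

definition scalar_measure :: "(real set \<Rightarrow> 'a::complex_inner \<Rightarrow> 'a) \<Rightarrow> 'a \<Rightarrow> real measure" where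
  "scalar_measure E x =
     measure_of UNIV (sets borel) (\<lambda>B. ennreal (Re (cinner (E B x) x)))"

definition simple_spectral_integral ::
    "(real set \<Rightarrow> 'a::complex_inner \<Rightarrow> 'a) \<Rightarrow> (real \<Rightarrow> complex) \<Rightarrow> 'a \<Rightarrow> 'a" where
  "simple_spectral_integral E s x = (\<Sum>c\<in>range s. c *\<^sub>C E (s -` {c}) x)"

text \<open>
  For simple \<open>s\<close>, the squared norm of \<open>simple_spectral_integral E s x\<close> is the integral of
  \<open>|s|\<^sup>2\<close> with respect to \<open>scalar_measure E x\<close>. The vector \<open>\<integral> f dE x\<close> is obtained by extending
  this isometry by continuity to all square integrable \<open>f\<close>.
\<close>

definition has_spectral_integral ::
    "(real set \<Rightarrow> 'a::complex_inner \<Rightarrow> 'a) \<Rightarrow> (real \<Rightarrow> complex) \<Rightarrow> 'a \<Rightarrow> 'a \<Rightarrow> bool" where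
  "has_spectral_integral E f x y \<longleftrightarrow>
     (\<exists>s. (\<forall>n::nat. simple_function borel (s n)) \<and>
          (\<lambda>n. \<integral>\<^sup>+t. ennreal ((cmod (f t - s n t))\<^sup>2) \<partial>scalar_measure E x) \<longlonglongrightarrow> 0 \<and>
          (\<lambda>n. simple_spectral_integral E (s n) x) \<longlonglongrightarrow> y)"

definition spectral_integral ::
    "(real set \<Rightarrow> 'a::complex_inner \<Rightarrow> 'a) \<Rightarrow> (real \<Rightarrow> complex) \<Rightarrow> 'a unbounded_op" where
  "spectral_integral E f = Unbounded_Op
     {x. (\<integral>\<^sup>+t. ennreal ((cmod (f t))\<^sup>2) \<partial>scalar_measure E x) < \<infinity>}
     (\<lambda>x. THE y. has_spectral_integral E f x y)"

text \<open>
  The spectral theorem says that for self-adjoint \<open>T\<close> there is a spectral measure \<open>E\<close>, uniquely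
  determined on Borel sets, with \<open>T = \<integral> t dE(t)\<close>. Values of \<open>E\<close> off the Borel sets are irrelevant.
\<close>

definition spectral_measure_of ::
    "'a::complex_inner unbounded_op \<Rightarrow> real set \<Rightarrow> 'a \<Rightarrow> 'a" where
  "spectral_measure_of T =
     (SOME E. spectral_measure E \<and> op_eq T (spectral_integral E complex_of_real))"

definition functional_calculus ::
    "(real \<Rightarrow> complex) \<Rightarrow> 'a::complex_inner unbounded_op \<Rightarrow> 'a unbounded_op" where
  "functional_calculus f T = spectral_integral (spectral_measure_of T) f"

text \<open>
  Meant for positive self-adjoint \<open>T\<close> and \<open>s > 0\<close>: the values of \<open>t powr s\<close> at \<open>t < 0\<close> are then
  irrelevant, since the spectral measure vanishes there.
\<close>

definition op_powr :: "'a::complex_inner unbounded_op \<Rightarrow> real \<Rightarrow> 'a unbounded_op" where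
  "op_powr T s = functional_calculus (\<lambda>t. complex_of_real (t powr s)) T"


section \<open>Forms\<close>

datatype 'a form = Form (form_dom: "'a set") (form_app: "'a \<Rightarrow> 'a \<Rightarrow> complex")

definition symmetric_form :: "'a::complex_inner form \<Rightarrow> bool" where
  "symmetric_form t \<longleftrightarrow> csubspace (form_dom t) \<and>
     (\<forall>f\<in>form_dom t. \<forall>g\<in>form_dom t. \<forall>h\<in>form_dom t.
        form_app t (f + g) h = form_app t f h + form_app t g h) \<and>
     (\<forall>a. \<forall>f\<in>form_dom t. \<forall>g\<in>form_dom t. form_app t (a *\<^sub>C f) g = a * form_app t f g) \<and>
     (\<forall>f\<in>form_dom t. \<forall>g\<in>form_dom t. form_app t f g = cnj (form_app t g f))"

definition semibounded_form :: "'a::complex_inner form \<Rightarrow> bool" where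
  "semibounded_form t \<longleftrightarrow> symmetric_form t \<and>
     (\<exists>c. \<forall>f\<in>form_dom t. Re (form_app t f f) \<ge> c * Re (cinner f f))"

definition closed_form :: "'a::complex_inner form \<Rightarrow> bool" where
  "closed_form t \<longleftrightarrow>
     (\<forall>f l. (\<forall>n::nat. f n \<in> form_dom t) \<longrightarrow> f \<longlonglongrightarrow> l \<longrightarrow>
        ((\<lambda>(n, m). form_app t (f n - f m) (f n - f m)) \<longlongrightarrow> 0) (sequentially \<times>\<^sub>F sequentially) \<longrightarrow>
        l \<in> form_dom t \<and> (\<lambda>n. form_app t (f n - l) (f n - l)) \<longlonglongrightarrow> 0)"

definition power_form :: "'a::complex_inner unbounded_op \<Rightarrow> real \<Rightarrow> nat \<Rightarrow> 'a form" where
  "power_form A c r =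
     (let B = op_powr (op_shift A c) (real r / 2)
      in Form (op_dom B)
           (\<lambda>f g. cinner (op_app B f) (op_app B g) + complex_of_real c * cinner f g))"

end

theory Submission
  imports Defs "HOL-Probability.Helly_Selection"
begin

text \<open>
  For every spectral measure \<open>E\<close> and Borel function \<open>f\<close> the operator \<open>T = \<integral> f dE\<close> is linear and closed:
  \<open>\<parallel>T x\<parallel>\<^sup>2 = \<integral> \<bar>f\<bar>\<^sup>2 d\<mu>\<^sub>x\<close> is a supremum of continuous quadratic functionals of \<open>x\<close>, hence lower semicontinuous
  (\<open>sq_integral_sup\<close>, \<open>spectral_integral_closed\<close>). Therefore \<open>\<langle>T x, T y\<rangle> + c \<langle>x, y\<rangle>\<close> is a symmetric form bounded below
  by \<open>c\<close>, and it is closed (\<open>closed_graph_form\<close>). The form \<open>t\<^sub>r\<close> is the case \<open>f t = t powr (r / 2)\<close>, \<open>c = \<gamma>\<close>, where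
  \<open>E\<close> is the spectral measure of \<open>A - \<gamma>\<close>.

  The functional calculus picks \<open>E\<close> by a choice operator, so what remains is that a spectral measure of
  \<open>A - \<gamma>\<close> exists (\<open>spectral_theorem_semibounded\<close>). If \<open>A \<ge> k\<close>, then \<open>R = (A - (k - 1))\<inverse>\<close> is an everywhere
  defined symmetric operator with \<open>0 \<le> R \<le> 1\<close> (\<open>resolvent_exists\<close>). For each vector \<open>x\<close> the functional
  \<open>p \<mapsto> \<langle>p(R) x, x\<rangle>\<close> on polynomials is nonnegative on the products \<open>t\<^sup>k (1 - t)\<^sup>j\<close>; by the Hausdorff moment theorem
  (\<open>hausdorff_moment_representation\<close>) it is integration against a measure \<open>\<mu> x\<close> on \<open>[0, 1]\<close>. Thus
  \<open>p \<mapsto> p(R) x\<close> is an isometry from the polynomials in \<open>L\<^sup>2(\<mu> x)\<close> into the Hilbert space. Polynomials being dense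
  (\<open>polynomials_dense_indicator\<close>), its continuous extension sends the indicator function of a Borel set \<open>B\<close>
  to a vector \<open>E B x\<close>, and these vectors form the spectral measure of \<open>R\<close>. The image of that measure under
  \<open>u \<mapsto> 1 / u + (k - 1) - \<gamma>\<close> is the spectral measure of \<open>A - \<gamma>\<close>.
\<close>


section \<open>The Hausdorff moment theorem\<close>

lemma borel_measurable_poly [measurable]: "poly (p :: real poly) \<in> borel_measurable borel"
  by (intro borel_measurable_continuous_onI continuous_intros)

text \<open>
  The Bernstein expansion of a monomial is exact, with coefficients that approximate
  the values of the monomial at the nodes \<open>k / N\<close>. It comes from multiplying \<open>X ^ n\<close> by
  \<open>(X + (1 - X)) ^ (N - n) = 1\<close>.
\<close>

lemma monomial_eq_bernstein_sum:
  fixes n N :: nat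
  assumes "n \<le> N"
  shows "[:0, 1::real:] ^ n =
    (\<Sum>k\<le>N. smult ((real k gchoose n) / (real N gchoose n) * real (N choose k))
               ([:0, 1:] ^ k * [:1, -1:] ^ (N - k)))"
proof -
  let ?X = "[:0, 1::real:]" and ?Y = "[:1, -1::real:]"
  let ?c = "\<lambda>k. (real k gchoose n) / (real N gchoose n) * real (N choose k)"
  have c0: "(real k gchoose n) = 0" if "k < n" for k
    using that by (simp add: binomial_gbinomial[symmetric])
  have Nn: "real (N choose n) \<noteq> 0"
    using assms by simp
  have c1: "?c (j + n) = real ((N - n) choose j)" if "j \<le> N - n" for j
  proof -
    have "(N choose (j + n)) * ((j + n) choose n) = (N choose n) * ((N - n) choose j)"
      using choose_mult[of n "j + n" N] that assms by simp
    then have "real (N choose (j + n)) * real ((j + n) choose n)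
             = real (N choose n) * real ((N - n) choose j)"
      by (metis of_nat_mult)
    then show ?thesis
      using Nn by (simp add: binomial_gbinomial[symmetric] field_simps del: of_nat_add)
  qed
  have "(\<Sum>k\<le>N. smult (?c k) (?X ^ k * ?Y ^ (N - k)))
      = (\<Sum>k\<in>{n..N}. smult (?c k) (?X ^ k * ?Y ^ (N - k)))"
    using c0 by (intro sum.mono_neutral_right) auto
  also have "\<dots> = (\<Sum>j\<in>{0..N-n}. smult (?c (j + n)) (?X ^ (j + n) * ?Y ^ (N - (j + n))))"
    using assms sum.shift_bounds_cl_nat_ivl[of "\<lambda>k. smult (?c k) (?X ^ k * ?Y ^ (N - k))" 0 n "N - n"]
    by simp
  also have "\<dots> = (\<Sum>j\<le>N-n. ?X ^ n * (of_nat ((N - n) choose j) * ?X ^ j * ?Y ^ (N - n - j)))"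
  proof (intro sum.cong)
    fix j assume "j \<in> {..N - n}"
    then show "smult (?c (j + n)) (?X ^ (j + n) * ?Y ^ (N - (j + n)))
        = ?X ^ n * (of_nat ((N - n) choose j) * ?X ^ j * ?Y ^ (N - n - j))"
      by (subst c1) (auto simp: power_add of_nat_poly algebra_simps)
  qed auto
  also have "\<dots> = ?X ^ n * (?X + ?Y) ^ (N - n)"
    by (subst binomial_ring) (simp add: sum_distrib_left)
  also have "?X + ?Y = 1"
    by (simp add: one_pCons)
  finally show ?thesis by simp
qed

lemma gbinomial_ratio_approx_power:
  fixes n N k :: nat
  assumes "2 * n < N" "k \<le> N"
  shows "\<bar>(real k / real N) ^ n - (real k gchoose n) / (real N gchoose n)\<bar> \<le> real n * (real n / (real N - real n))"
proof -
  have ratio: "(real k gchoose n) / (real N gchoose n) = (\<Prod>i\<in>{0..<n}. (real k - real i) / (real N - real i))"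
    by (simp add: gbinomial_prod_rev prod_dividef)
  have bound: "\<bar>real k / real N - (real k - real i) / (real N - real i)\<bar> \<le> real n / (real N - real n)"
    if "i < n" for i
  proof -
    have "real k / real N - (real k - real i) / (real N - real i)
        = (real i / (real N - real i)) * ((real N - real k) / real N)"
      using assms that by (simp add: field_simps)
    also have "\<bar>\<dots>\<bar> \<le> (real n / (real N - real n)) * 1"
      unfolding abs_mult
      using assms that by (intro mult_mono) (auto intro!: frac_le simp: divide_le_eq_1)
    finally show ?thesis by simp
  qed
  have "\<bar>(\<Prod>i\<in>{0..<n}. real k / real N) - (\<Prod>i\<in>{0..<n}. (real k - real i) / (real N - real i))\<bar>
      \<le> (\<Sum>i\<in>{0..<n}. \<bar>real k / real N - (real k - real i) / (real N - real i)\<bar>)"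
    using norm_prod_diff[of "{0..<n}" "\<lambda>_. real k / real N"
        "\<lambda>i. (real k - real i) / (real N - real i)"] assms
    by (auto simp: abs_le_iff divide_le_eq_1 field_simps)
  also have "\<dots> \<le> (\<Sum>i\<in>{0..<n}. real n / (real N - real n))"
    using bound by (intro sum_mono) auto
  finally show ?thesis
    by (simp add: ratio)
qed

text \<open>
  The Hausdorff moment theorem, for linear functionals on polynomials. Up to normalisation, the
  representing measure is a weak limit of the discrete measures that give the node \<open>k / N\<close> the mass
  \<open>L\<close> of the \<open>k\<close>-th Bernstein polynomial of degree \<open>N\<close>; these live on \<open>[0, 1]\<close>, so Helly's selection
  theorem applies.
\<close>

theorem hausdorff_moment_representation:
  fixes L :: "real poly \<Rightarrow> real"
  assumes add: "\<And>p q. L (p + q) = L p + L q"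
    and smult: "\<And>c p. L (smult c p) = c * L p"
    and pos: "\<And>k j. 0 \<le> L ([:0, 1:] ^ k * [:1, -1:] ^ j)"
  obtains M where "finite_measure M" "sets M = sets borel" "AE t in M. t \<in> {0..1}"
    "\<And>p. L p = (\<integral>t. poly p t \<partial>M)"
proof -
  have L0: "L 0 = 0"
    using smult[of 0 0] by simp
  have Lsum: "L (\<Sum>i\<in>I. p i) = (\<Sum>i\<in>I. L (p i))" for p and I :: "nat set"
    by (induction I rule: infinite_finite_induct) (auto simp: add L0)
  define w where "w N k = real (N choose k) * L ([:0, 1:] ^ k * [:1, -1:] ^ (N - k))" for N k
  have w_nonneg: "0 \<le> w N k" for N k
    unfolding w_def using pos by simp
  have L_power: "L ([:0, 1:] ^ n) = (\<Sum>k\<le>N. (real k gchoose n) / (real N gchoose n) * w N k)"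
    if "n \<le> N" for n N
    by (subst monomial_eq_bernstein_sum[OF that]) (simp add: Lsum smult w_def mult.assoc)
  have w_sum: "(\<Sum>k\<le>N. w N k) = L 1" for N
    using L_power[of 0 N] by simp
  have L1: "0 \<le> L 1"
    using pos[of 0 0] by simp
  have mom: "(\<lambda>N. \<Sum>k\<le>N. (real k / real N) ^ n * w N k) \<longlonglongrightarrow> L ([:0, 1:] ^ n)" for n
  proof (rule LIM_zero_cancel, rule Lim_null_comparison)
    show "(\<lambda>N. real n * (real n / (real N - real n)) * L 1) \<longlonglongrightarrow> 0"
    proof -
      have "filterlim (\<lambda>N. real N - real n) at_top sequentially"
        by (simp add: filterlim_at_top_add_at_top filterlim_real_sequentially
            filterlim_tendsto_add_at_top[of "\<lambda>_. - real n" "- real n", simplified])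
      then have "(\<lambda>N. real n / (real N - real n)) \<longlonglongrightarrow> 0"
        by (intro tendsto_divide_0[OF tendsto_const] filterlim_at_top_imp_at_infinity)
      then show ?thesis
        by (intro tendsto_mult_left_zero tendsto_mult_right_zero)
    qed
    have "norm ((\<Sum>k\<le>N. (real k / real N) ^ n * w N k) - L ([:0, 1:] ^ n))
        \<le> real n * (real n / (real N - real n)) * L 1" if "2 * n < N" for N
    proof -
      have "(\<Sum>k\<le>N. (real k / real N) ^ n * w N k) - L ([:0, 1:] ^ n)
          = (\<Sum>k\<le>N. ((real k / real N) ^ n - (real k gchoose n) / (real N gchoose n)) * w N k)"
        using that by (simp add: L_power[of n N] sum_subtractf left_diff_distrib)
      also have "norm \<dots> \<le> (\<Sum>k\<le>N. real n * (real n / (real N - real n)) * w N k)"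
        using w_nonneg
        by (intro sum_norm_le)
           (auto simp: abs_mult simp del: times_divide_eq_right
                 intro!: mult_right_mono gbinomial_ratio_approx_power[OF that])
      also have "\<dots> = real n * (real n / (real N - real n)) * L 1"
        unfolding w_sum[of N, symmetric] by (rule sum_distrib_left[symmetric])
      finally show ?thesis .
    qed
    then show "\<forall>\<^sub>F N in sequentially. norm ((\<Sum>k\<le>N. (real k / real N) ^ n * w N k) - L ([:0, 1:] ^ n))
        \<le> real n * (real n / (real N - real n)) * L 1"
      by (rule eventually_mono[OF eventually_gt_at_top[of "2 * n"]])
  qed
  have L_monomials: "L p = (\<Sum>i\<le>degree p. coeff p i * L ([:0, 1:] ^ i))" for p
  proof -
    have "p = (\<Sum>i\<le>degree p. smult (coeff p i) ([:0, 1:] ^ i))"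
      by (subst poly_as_sum_of_monoms[of p, symmetric]) (simp add: monom_altdef)
    then have "L p = L (\<Sum>i\<le>degree p. smult (coeff p i) ([:0, 1:] ^ i))"
      by simp
    then show ?thesis
      by (simp add: Lsum smult)
  qed
  show ?thesis
  proof (cases "L 1 = 0")
    case True
    have "w N k = 0" if "k \<le> N" for N k
      using w_sum[of N] True that sum_nonneg_eq_0_iff[of "{..N}" "w N"] w_nonneg by auto
    then have "(\<lambda>N. \<Sum>k\<le>N. (real k / real N) ^ n * w N k) = (\<lambda>_. 0)" for n
      by auto
    then have "L ([:0, 1:] ^ n) = 0" for n
      using mom[of n] by (simp add: LIMSEQ_const_iff)
    then have "L p = 0" for p
      by (subst L_monomials) simp
    then show ?thesis
      by (intro that[of "null_measure borel"]) (auto intro!: finite_measureI AE_I[where N = UNIV])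
  next
    case False
    with L1 have Lpos: "0 < L 1"
      by simp
    \<comment> \<open>The discrete probability measures with mass \<open>w N k / L 1\<close> at \<open>k / N\<close>.\<close>
    define \<mu> where "\<mu> N = distr (point_measure {..N} (\<lambda>k. w N k / L 1)) borel (\<lambda>k. real k / real N)" for N
    have int_\<mu>: "(\<integral>t. g t \<partial>\<mu> N) = (\<Sum>k\<le>N. w N k / L 1 * g (real k / real N))"
      if [measurable]: "g \<in> borel_measurable borel" for g :: "real \<Rightarrow> real" and N
    proof -
      have "(\<lambda>k. real k / real N) \<in> measurable (point_measure {..N} (\<lambda>k. ennreal (w N k / L 1))) borel"
        by (simp add: point_measure_def)
      then show ?thesis
        unfolding \<mu>_def using w_nonneg Lpos
        by (simp add: integral_distr lebesgue_integral_point_measure_finite)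
    qed
    have frac: "real k / real N \<in> {0..1}" if "k \<le> N" for k N :: nat
      using that by (auto simp: divide_le_eq_1)
    have dist_\<mu>: "real_distribution (\<mu> N)" for N
    proof -
      have "emeasure (point_measure {..N} (\<lambda>k. ennreal (w N k / L 1))) {..N} = ennreal (\<Sum>k\<le>N. w N k / L 1)"
        using w_nonneg Lpos by (subst emeasure_point_measure_finite) (auto intro!: sum_ennreal)
      also have "(\<Sum>k\<le>N. w N k / L 1) = 1"
        using Lpos by (simp add: w_sum flip: sum_divide_distrib)
      finally have "prob_space (point_measure {..N} (\<lambda>k. ennreal (w N k / L 1)))"
        by (intro prob_spaceI) (simp add: space_point_measure)
      then show ?thesis
        unfolding \<mu>_def real_distribution_def real_distribution_axioms_def
        by (auto intro!: prob_space.prob_space_distr)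
    qed
    have tight_\<mu>: "tight \<mu>"
      unfolding tight_def
    proof (intro conjI allI impI dist_\<mu>, rule exI[of _ "-1"], rule exI[of _ 1], intro conjI allI)
      fix e :: real and N assume "0 < e"
      interpret real_distribution "\<mu> N" by (rule dist_\<mu>)
      have "measure (\<mu> N) {-1<..1} = (\<integral>t. indicator {-1<..1} t \<partial>\<mu> N)"
        by simp
      also have "\<dots> = (\<Sum>k\<le>N. w N k / L 1 * indicator {-1<..1} (real k / real N))"
        by (rule int_\<mu>) simp
      also have "\<dots> = (\<Sum>k\<le>N. w N k / L 1)"
      proof (intro sum.cong refl)
        fix k assume "k \<in> {..N}"
        then have "real k / real N \<in> {-1<..1}"
          using frac[of k N] by (auto intro: less_le_trans[of "-1" 0])
        then show "w N k / L 1 * indicator {-1<..1} (real k / real N) = w N k / L 1"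
          by simp
      qed
      also have "\<dots> = 1"
        using Lpos by (simp add: w_sum flip: sum_divide_distrib)
      finally show "1 - e < measure (\<mu> N) {-1<..1}"
        using \<open>0 < e\<close> by simp
    qed auto
    obtain r M where r: "strict_mono (r :: nat \<Rightarrow> nat)" and M: "real_distribution M"
      and conv: "weak_conv_m (\<mu> \<circ> id \<circ> r) M"
      using tight_imp_convergent_subsubsequence[OF tight_\<mu> strict_mono_id] by blast
    interpret M: real_distribution M by (rule M)
    have lim: "(\<lambda>j. \<Sum>k\<le>r j. w (r j) k / L 1 * g (real k / real (r j))) \<longlonglongrightarrow> (\<integral>t. g t \<partial>M)"
      if "continuous_on UNIV g" "\<And>t. \<bar>g t\<bar> \<le> 1" for g :: "real \<Rightarrow> real"
    proof -
      have "g \<in> borel_measurable borel"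
        using that(1) by (rule borel_measurable_continuous_onI)
      moreover have "(\<lambda>j. \<integral>t. g t \<partial>(\<mu> \<circ> id \<circ> r) j) \<longlonglongrightarrow> (\<integral>t. g t \<partial>M)"
        using that dist_\<mu> M conv
        by (intro weak_conv_imp_integral_bdd_continuous_conv[where B = 1])
           (auto simp: continuous_on_eq_continuous_at comp_def)
      ultimately show ?thesis
        by (simp add: int_\<mu>)
    qed
    \<comment> \<open>A bounded continuous function that vanishes exactly on \<open>[0, 1]\<close>.\<close>
    let ?d = "\<lambda>t::real. min 1 (max 0 (max (t - 1) (- t)))"
    have "(\<lambda>j. \<Sum>k\<le>r j. w (r j) k / L 1 * ?d (real k / real (r j))) \<longlonglongrightarrow> (\<integral>t. ?d t \<partial>M)"
      by (rule lim) (auto intro!: continuous_intros)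
    moreover have "(\<Sum>k\<le>r j. w (r j) k / L 1 * ?d (real k / real (r j))) = 0" for j
    proof (intro sum.neutral ballI)
      fix k assume "k \<in> {..r j}"
      then have "?d (real k / real (r j)) = 0"
        using frac[of k "r j"] by simp
      then show "w (r j) k / L 1 * ?d (real k / real (r j)) = 0"
        by simp
    qed
    ultimately have "(\<integral>t. ?d t \<partial>M) = 0"
      by (simp add: LIMSEQ_const_iff)
    then have "AE t in M. ?d t = 0"
      by (subst (asm) integral_nonneg_eq_0_iff_AE) (auto intro!: M.integrable_const_bound[where B = 1])
    then have supp: "AE t in M. t \<in> {0..1}"
      by eventually_elim (auto simp: min_def max_def split: if_splits)
    have "(\<integral>t. t ^ n \<partial>M) = L ([:0, 1:] ^ n) / L 1" for n
    proof -
      \<comment> \<open>The power function is unbounded; on \<open>[0, 1]\<close> it agrees with this bounded continuous function.\<close>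
      let ?h = "\<lambda>t::real. (max 0 (min 1 t)) ^ n"
      have "(\<lambda>j. \<Sum>k\<le>r j. w (r j) k / L 1 * ?h (real k / real (r j))) \<longlonglongrightarrow> (\<integral>t. ?h t \<partial>M)"
        by (rule lim) (auto intro!: continuous_intros power_le_one simp: abs_le_iff order_trans[OF _ zero_le_power])
      moreover have "(\<Sum>k\<le>N. w N k / L 1 * ?h (real k / real N))
          = (\<Sum>k\<le>N. (real k / real N) ^ n * w N k) / L 1" for N
        unfolding sum_divide_distrib
      proof (intro sum.cong refl)
        fix k assume "k \<in> {..N}"
        then have "max 0 (min 1 (real k / real N)) = real k / real N"
          using frac[of k N] by simp
        then show "w N k / L 1 * ?h (real k / real N) = (real k / real N) ^ n * w N k / L 1"
          by simp
      qed
      ultimately have lim1: "(\<lambda>j. (\<Sum>k\<le>r j. (real k / real (r j)) ^ n * w (r j) k) / L 1) \<longlonglongrightarrow> (\<integral>t. ?h t \<partial>M)"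
        by simp
      have lim2: "(\<lambda>j. (\<Sum>k\<le>r j. (real k / real (r j)) ^ n * w (r j) k) / L 1) \<longlonglongrightarrow> L ([:0, 1:] ^ n) / L 1"
        using LIMSEQ_subseq_LIMSEQ[OF mom r, of n] False by (intro tendsto_divide) (auto simp: o_def)
      have "AE t in M. ?h t = t ^ n"
        using supp by eventually_elim simp
      then have "(\<integral>t. ?h t \<partial>M) = (\<integral>t. t ^ n \<partial>M)"
        by (intro integral_cong_AE) auto
      then show ?thesis
        using LIMSEQ_unique[OF lim1 lim2] by simp
    qed
    note moments = this
    have integrable_power: "integrable M (\<lambda>t. t ^ n)" for n
    proof (rule M.integrable_const_bound[where B = 1])
      show "AE t in M. norm (t ^ n) \<le> 1"
        using supp by eventually_elim (simp add: power_le_one)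
    qed simp
    have Lp: "L p = L 1 * (\<integral>t. poly p t \<partial>M)" for p
    proof -
      have "(\<integral>t. poly p t \<partial>M) = (\<Sum>i\<le>degree p. coeff p i * (L ([:0, 1:] ^ i) / L 1))"
        unfolding poly_altdef using integrable_power moments by simp
      also have "\<dots> = L p / L 1"
        by (simp add: L_monomials[of p] sum_divide_distrib)
      finally show ?thesis
        using False by simp
    qed
    have int_density: "(\<integral>t. g t \<partial>density M (\<lambda>_. ennreal (L 1))) = L 1 * (\<integral>t. g t \<partial>M)"
      if "g \<in> borel_measurable borel" for g :: "real \<Rightarrow> real"
    proof -
      have "g \<in> borel_measurable M"
        using that by simp
      then show ?thesis
        using L1 by (subst integral_density) simp_all
    qed
    show ?thesis
    proof (rule that[of "density M (\<lambda>_. ennreal (L 1))"])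
      have "emeasure (density M (\<lambda>_. ennreal (L 1))) (space M) = ennreal (L 1) * emeasure M (space M)"
        by (subst emeasure_density) (rule measurable_const sets.top nn_integral_cmult_indicator | simp)+
      then show "finite_measure (density M (\<lambda>_. ennreal (L 1)))"
        using M.emeasure_space_1 by (intro finite_measureI) (simp del: M.space_eq_univ)
      have "AE t in M. 0 < ennreal (L 1) \<longrightarrow> t \<in> {0..1}"
        using supp by eventually_elim (rule impI)
      then show "AE t in density M (\<lambda>_. ennreal (L 1)). t \<in> {0..1}"
        by (rule iffD2[OF AE_density, rotated]) (rule measurable_const, simp)
      show "L p = (\<integral>t. poly p t \<partial>density M (\<lambda>_. ennreal (L 1)))" for p
        by (rule trans[OF Lp int_density[symmetric]]) simp
    qed simp
  qed
qed


section \<open>Polynomial approximation in mean square\<close>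

text \<open>
  Borel functions that are bounded on \<open>[0, 1]\<close>; no bound is required elsewhere, so that
  polynomials qualify.
\<close>

definition bounded_borel :: "(real \<Rightarrow> real) \<Rightarrow> bool" where
  "bounded_borel g \<longleftrightarrow> g \<in> borel_measurable borel \<and> (\<exists>C. \<forall>t\<in>{0..1}. \<bar>g t\<bar> \<le> C)"

text \<open>
  Finite Borel measures on the line concentrated on \<open>[0, 1]\<close>.
\<close>

definition unit_measure :: "real measure \<Rightarrow> bool" where
  "unit_measure M \<longleftrightarrow> finite_measure M \<and> sets M = sets borel \<and> (AE t in M. t \<in> {0..1})"

lemma bounded_borel_measurable [measurable_dest]: "bounded_borel g \<Longrightarrow> g \<in> borel_measurable borel"
  by (simp add: bounded_borel_def)

lemma bounded_borel_const: "bounded_borel (\<lambda>t. c)"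
  by (auto simp: bounded_borel_def)

lemma bounded_borel_indicator: "B \<in> sets borel \<Longrightarrow> bounded_borel (indicator B)"
  by (auto simp: bounded_borel_def indicator_def intro!: exI[of _ 1])

lemma bounded_borel_poly: "bounded_borel (poly p)"
proof -
  have "bounded (poly p ` {0..1})"
    by (intro compact_imp_bounded compact_continuous_image continuous_intros) simp
  then show ?thesis
    by (auto simp: bounded_borel_def bounded_iff)
qed

lemma bounded_borel_add:
  assumes "bounded_borel g" "bounded_borel h"
  shows "bounded_borel (\<lambda>t. g t + h t)"
proof -
  obtain C D where "\<forall>t\<in>{0..1}. \<bar>g t\<bar> \<le> C" "\<forall>t\<in>{0..1}. \<bar>h t\<bar> \<le> D"
    using assms by (auto simp: bounded_borel_def)
  then have "\<forall>t\<in>{0..1}. \<bar>g t + h t\<bar> \<le> C + D"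
    by (meson abs_triangle_ineq add_mono order_trans)
  with assms show ?thesis
    by (auto simp: bounded_borel_def)
qed

lemma bounded_borel_mult:
  assumes "bounded_borel g" "bounded_borel h"
  shows "bounded_borel (\<lambda>t. g t * h t)"
proof -
  obtain C D where "\<forall>t\<in>{0..1}. \<bar>g t\<bar> \<le> C" "\<forall>t\<in>{0..1}. \<bar>h t\<bar> \<le> D"
    using assms by (auto simp: bounded_borel_def)
  then have "\<forall>t\<in>{0..1}. \<bar>g t * h t\<bar> \<le> C * D"
    by (auto simp: abs_mult intro!: mult_mono)
  with assms show ?thesis
    by (auto simp: bounded_borel_def)
qed

lemma bounded_borel_diff:
  assumes "bounded_borel g" "bounded_borel h"
  shows "bounded_borel (\<lambda>t. g t - h t)"
  using bounded_borel_add[OF assms(1) bounded_borel_mult[OF bounded_borel_const[of "-1"] assms(2)]]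
  by simp

lemma bounded_borel_power2: "bounded_borel g \<Longrightarrow> bounded_borel (\<lambda>t. (g t)\<^sup>2)"
  unfolding power2_eq_square by (intro bounded_borel_mult)

lemma bounded_borel_divide: "bounded_borel g \<Longrightarrow> bounded_borel (\<lambda>t. g t / c)"
  using bounded_borel_mult[OF _ bounded_borel_const[of "1 / c"]] by simp

lemma bounded_borel_id: "bounded_borel (\<lambda>t. t)"
  by (auto simp: bounded_borel_def)

lemmas bounded_borel_intros =
  bounded_borel_const bounded_borel_indicator bounded_borel_poly bounded_borel_id
  bounded_borel_add bounded_borel_diff bounded_borel_mult bounded_borel_divide bounded_borel_power2

lemma integrable_bounded_borel:
  assumes M: "unit_measure M" and g: "bounded_borel g"
  shows "integrable M g"
proof -
  interpret finite_measure M
    using M by (simp add: unit_measure_def)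
  obtain C where C: "\<forall>t\<in>{0..1}. \<bar>g t\<bar> \<le> C"
    using g by (auto simp: bounded_borel_def)
  show ?thesis
  proof (rule integrable_const_bound)
    have "AE t in M. t \<in> {0..1}"
      using M by (simp add: unit_measure_def)
    then show "AE t in M. norm (g t) \<le> C"
      by eventually_elim (use C in auto)
    have "borel_measurable M = (borel_measurable borel :: (real \<Rightarrow> real) set)"
      using M by (intro measurable_cong_sets) (auto simp: unit_measure_def)
    then show "g \<in> borel_measurable M"
      using g by (simp add: bounded_borel_def)
  qed
qed

lemma L2_tendsto_integral_mult:
  assumes M: "unit_measure M" and g: "bounded_borel g" and h: "\<And>n. bounded_borel (h n)"
    and lim: "(\<lambda>n. \<integral>t. (h n t)\<^sup>2 \<partial>M) \<longlonglongrightarrow> 0"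
  shows "(\<lambda>n. \<integral>t. h n t * g t \<partial>M) \<longlonglongrightarrow> 0"
proof (rule LIMSEQ_I)
  fix e :: real assume "0 < e"
  define G where "G = (\<integral>t. (g t)\<^sup>2 \<partial>M)"
  have "0 \<le> G"
    by (simp add: G_def)
  define d where "d = e / (G + 1)"
  have d: "0 < d" "d * G < e"
    using \<open>0 < e\<close> \<open>0 \<le> G\<close> by (auto simp: d_def field_simps)
  obtain N where N: "\<And>n. n \<ge> N \<Longrightarrow> (\<integral>t. (h n t)\<^sup>2 \<partial>M) < e * d"
    using LIMSEQ_D[OF lim, of "e * d"] d \<open>0 < e\<close> by auto
  show "\<exists>N. \<forall>n\<ge>N. norm ((\<integral>t. h n t * g t \<partial>M) - 0) < e"
  proof (intro exI[of _ N] allI impI)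
    fix n assume "N \<le> n"
    \<comment> \<open>Young's inequality with the weight \<open>d\<close>.\<close>
    have young: "\<bar>h n t * g t\<bar> \<le> (1 / (2 * d)) * (h n t)\<^sup>2 + (d / 2) * (g t)\<^sup>2" for t
    proof -
      have "0 \<le> (\<bar>h n t\<bar> - d * \<bar>g t\<bar>)\<^sup>2 / (2 * d)"
        using d by simp
      also have "\<dots> = (1 / (2 * d)) * (h n t)\<^sup>2 + (d / 2) * (g t)\<^sup>2 - \<bar>h n t\<bar> * \<bar>g t\<bar>"
        using d by (simp add: power2_diff power_mult_distrib field_simps power2_eq_square)
      finally show ?thesis
        by (simp add: abs_mult)
    qed
    have "\<bar>\<integral>t. h n t * g t \<partial>M\<bar> \<le> (\<integral>t. \<bar>h n t * g t\<bar> \<partial>M)"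
      using integral_abs_bound by blast
    also have "\<dots> \<le> (\<integral>t. (1 / (2 * d)) * (h n t)\<^sup>2 + (d / 2) * (g t)\<^sup>2 \<partial>M)"
      using young by (intro integral_mono integrable_abs integrable_bounded_borel[OF M] bounded_borel_intros g h)
    also have "\<dots> = (1 / (2 * d)) * (\<integral>t. (h n t)\<^sup>2 \<partial>M) + (d / 2) * G"
      unfolding G_def
      by (subst Bochner_Integration.integral_add)
         (auto intro!: integrable_bounded_borel[OF M] bounded_borel_intros g h)
    also have "\<dots> < (1 / (2 * d)) * (e * d) + (1/2) * e"
      using N[OF \<open>N \<le> n\<close>] d by (intro add_strict_mono mult_strict_left_mono) auto
    also have "\<dots> = e"
      using d by simp
    finally show "norm ((\<integral>t. h n t * g t \<partial>M) - 0) < e"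
      by simp
  qed
qed

lemma compact_open_sandwich:
  assumes M: "unit_measure M" and B: "B \<in> sets borel" and "0 < e"
  obtains K U where "compact K" "open U" "K \<subseteq> B" "B \<subseteq> U" "measure M (U - K) < e"
proof -
  interpret finite_measure M
    using M by (simp add: unit_measure_def)
  have sets: "sets M = sets borel"
    using M by (simp add: unit_measure_def)
  have fin: "emeasure M (space M) \<noteq> \<infinity>"
    by simp
  have "\<exists>K. K \<subseteq> B \<and> compact K \<and> measure M B - e / 2 < measure M K"
  proof (rule ccontr)
    assume neg: "\<not> ?thesis"
    then have "emeasure M K \<le> ennreal (measure M B - e / 2)" if "K \<subseteq> B" "compact K" for K
      using that by (auto simp: emeasure_eq_measure not_less intro!: ennreal_leI)
    then have "emeasure M B \<le> ennreal (measure M B - e / 2)"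
      unfolding inner_regular[OF sets fin B] by (intro SUP_least) auto
    moreover have "0 \<le> measure M B - e / 2"
      using neg by (auto dest: spec[of _ "{}"])
    ultimately show False
      using \<open>0 < e\<close> by (simp add: emeasure_eq_measure)
  qed
  then obtain K where K: "K \<subseteq> B" "compact K" "measure M B - e / 2 < measure M K"
    by blast
  have "\<exists>U. B \<subseteq> U \<and> open U \<and> measure M U < measure M B + e / 2"
  proof (rule ccontr)
    assume "\<not> ?thesis"
    then have "ennreal (measure M B + e / 2) \<le> emeasure M U" if "B \<subseteq> U" "open U" for U
      using that by (auto simp: emeasure_eq_measure not_less intro!: ennreal_leI)
    then have "ennreal (measure M B + e / 2) \<le> emeasure M B"
      unfolding outer_regular[OF sets fin B] by (intro INF_greatest) auto
    then show False
      using \<open>0 < e\<close> by (simp add: emeasure_eq_measure)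
  qed
  then obtain U where U: "B \<subseteq> U" "open U" "measure M U < measure M B + e / 2"
    by blast
  have "measure M (U - K) = measure M U - measure M K"
    using K U by (intro finite_measure_Diff) (auto simp: sets compact_imp_closed)
  then show ?thesis
    using that[of K U] K U by simp
qed

text \<open>
  Polynomials approximate an indicator function in \<open>L\<^sup>2\<close> of finitely many measures at once.
  Simultaneity is what later makes the spectral projections additive without any comparison between the
  measures of \<open>x\<close>, \<open>y\<close> and \<open>x + y\<close>. The proof takes the union of the inner compact sets
  and the intersection of the outer open sets supplied by regularity, a Urysohn function between them,
  and the Weierstrass theorem.
\<close>

theorem polynomials_dense_indicator:
  fixes M :: "'i \<Rightarrow> real measure"
  assumes I: "finite I" and M: "\<And>i. i \<in> I \<Longrightarrow> unit_measure (M i)"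
    and B: "B \<in> sets borel" and e: "0 < e"
  obtains p :: "real poly" where "\<And>i. i \<in> I \<Longrightarrow> (\<integral>t. (poly p t - indicator B t)\<^sup>2 \<partial>M i) < e"
proof -
  have "\<forall>i\<in>I. \<exists>K U. compact K \<and> open U \<and> K \<subseteq> B \<and> B \<subseteq> U \<and> measure (M i) (U - K) < e / 8"
  proof
    fix i assume "i \<in> I"
    show "\<exists>K U. compact K \<and> open U \<and> K \<subseteq> B \<and> B \<subseteq> U \<and> measure (M i) (U - K) < e / 8"
      by (rule compact_open_sandwich[OF M[OF \<open>i \<in> I\<close>] B, of "e / 8"]) (use e in auto)
  qed
  then obtain K U where KU: "\<And>i. i \<in> I \<Longrightarrow> compact (K i)" "\<And>i. i \<in> I \<Longrightarrow> open (U i)"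
    "\<And>i. i \<in> I \<Longrightarrow> K i \<subseteq> B" "\<And>i. i \<in> I \<Longrightarrow> B \<subseteq> U i"
    "\<And>i. i \<in> I \<Longrightarrow> measure (M i) (U i - K i) < e / 8"
    by metis
  have "closed (\<Union>i\<in>I. K i)"
    using I KU(1) by (intro closed_UN) (auto intro: compact_imp_closed)
  moreover have "closed (- (\<Inter>i\<in>I. U i))"
    using I KU(2) by (intro closed_Compl open_INT) auto
  moreover have "(\<Union>i\<in>I. K i) \<inter> - (\<Inter>i\<in>I. U i) = {}"
    using KU(3,4) by fastforce
  ultimately obtain f :: "real \<Rightarrow> real" where f: "continuous_on UNIV f" "\<And>t. f t \<in> closed_segment 1 0"
    "\<And>t. t \<in> (\<Union>i\<in>I. K i) \<Longrightarrow> f t = 1" "\<And>t. t \<in> - (\<Inter>i\<in>I. U i) \<Longrightarrow> f t = 0"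
    by (rule Urysohn[where a = 1 and b = 0]) blast
  define m where "m = (\<Sum>i\<in>I. measure (M i) (space (M i)))"
  have m: "measure (M i) (space (M i)) \<le> m" if "i \<in> I" for i
    unfolding m_def using I that by (intro member_le_sum) auto
  have "0 \<le> m"
    unfolding m_def by (intro sum_nonneg) auto
  define d where "d = sqrt (e / (8 * (m + 1)))"
  have d: "0 < d" "d\<^sup>2 * m \<le> e / 8"
    using e \<open>0 \<le> m\<close> by (auto simp: d_def field_simps)
  obtain g where g: "real_polynomial_function g" "\<And>t. t \<in> {0..1} \<Longrightarrow> \<bar>f t - g t\<bar> < d"
    using Stone_Weierstrass_real_polynomial_function[of "{0..1}" f d] f(1) d(1)
      continuous_on_subset by (metis compact_Icc subset_UNIV)
  obtain a n where "g = (\<lambda>x. \<Sum>i\<le>n. a i * x ^ i)"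
    using real_polynomial_function_imp_sum[OF g(1)] by blast
  then have "g = poly (\<Sum>i\<le>n. monom (a i) i)"
    by (auto simp: poly_sum poly_monom)
  then obtain p where p: "\<And>t. t \<in> {0..1} \<Longrightarrow> \<bar>f t - poly p t\<bar> < d"
    using g(2) by blast
  show ?thesis
  proof (rule that)
    fix i assume i: "i \<in> I"
    interpret finite_measure "M i"
      using M[OF i] by (simp add: unit_measure_def)
    have UK: "U i - K i \<in> sets borel"
      using KU(1,2)[OF i] by (auto simp: compact_imp_closed)
    have "AE t in M i. t \<in> {0..1}"
      using M[OF i] by (simp add: unit_measure_def)
    then have "AE t in M i. (poly p t - indicator B t)\<^sup>2 \<le> 2 * d\<^sup>2 + 2 * indicator (U i - K i) t"
    proof eventually_elim
      fix t :: real assume t: "t \<in> {0..1}"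
      have "\<bar>f t - indicator B t\<bar> \<le> indicator (U i - K i) t"
      proof -
        have f01: "0 \<le> f t" "f t \<le> 1"
          using f(2)[of t] by (auto simp: closed_segment_eq_real_ivl)
        consider "t \<in> K i" | "t \<notin> U i" | "t \<in> U i - K i"
          by blast
        then show ?thesis
        proof cases
          case 1
          then show ?thesis
            using f(3)[of t] i KU(3)[OF i] by (auto simp: indicator_def)
        next
          case 2
          then show ?thesis
            using f(4)[of t] i KU(4)[OF i] by (auto simp: indicator_def)
        next
          case 3
          then show ?thesis
            using f01 by (auto simp: indicator_def)
        qed
      qed
      then have "(f t - indicator B t)\<^sup>2 \<le> (indicator (U i - K i) t)\<^sup>2"
        by (simp add: abs_le_square_iff[symmetric])
      also have "\<dots> = indicator (U i - K i) t"
        by (simp add: indicator_def)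
      finally have 1: "(f t - indicator B t)\<^sup>2 \<le> indicator (U i - K i) t" .
      have 2: "(poly p t - f t)\<^sup>2 \<le> d\<^sup>2"
        using p[OF t] by (intro iffD1[OF abs_le_square_iff]) auto
      have "(poly p t - indicator B t)\<^sup>2
          = 2 * (poly p t - f t)\<^sup>2 + 2 * (f t - indicator B t)\<^sup>2 - (poly p t - 2 * f t + indicator B t)\<^sup>2"
        by (simp add: power2_eq_square algebra_simps)
      also have "\<dots> \<le> 2 * d\<^sup>2 + 2 * indicator (U i - K i) t"
        using 1 2 zero_le_power2[of "poly p t - 2 * f t + indicator B t"] by linarith
      finally show "(poly p t - indicator B t)\<^sup>2 \<le> 2 * d\<^sup>2 + 2 * indicator (U i - K i) t" .
    qed
    then have "(\<integral>t. (poly p t - indicator B t)\<^sup>2 \<partial>M i)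
        \<le> (\<integral>t. 2 * d\<^sup>2 + 2 * indicator (U i - K i) t \<partial>M i)"
      by (intro integral_mono_AE integrable_bounded_borel[OF M[OF i]] bounded_borel_intros B UK)
    also have "\<dots> = 2 * d\<^sup>2 * measure (M i) (space (M i)) + 2 * measure (M i) (U i - K i)"
    proof -
      have "(\<integral>t. indicator (U i - K i) t \<partial>M i) = measure (M i) (U i - K i)"
        using UK M[OF i] by (simp add: unit_measure_def sets_eq_imp_space_eq)
      then show ?thesis
        by (subst Bochner_Integration.integral_add)
           (auto intro!: integrable_bounded_borel[OF M[OF i]] bounded_borel_intros UK)
    qed
    also have "\<dots> < e"
    proof -
      have "d\<^sup>2 * measure (M i) (space (M i)) \<le> d\<^sup>2 * m"
        using m[OF i] by (intro mult_left_mono) auto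
      then show ?thesis
        using d(2) KU(5)[OF i] e by linarith
    qed
    finally show "(\<integral>t. (poly p t - indicator B t)\<^sup>2 \<partial>M i) < e" .
  qed
qed


section \<open>Spectral projections of a positive contraction\<close>

lemma tendsto_zero_double_bound:
  fixes a b c :: "nat \<Rightarrow> real"
  assumes "\<And>n. \<bar>a n\<bar> \<le> 2 * b n + 2 * c n" "b \<longlonglongrightarrow> 0" "c \<longlonglongrightarrow> 0"
  shows "a \<longlonglongrightarrow> 0"
proof (rule Lim_null_comparison[OF always_eventually])
  show "(\<lambda>n. 2 * b n + 2 * c n) \<longlonglongrightarrow> 0"
    using tendsto_add[OF tendsto_mult_left[OF assms(2), of 2] tendsto_mult_left[OF assms(3), of 2]]
    by simp
qed (use assms(1) in auto)

text \<open>
  The operator \<open>p(R)\<close>, evaluated by Horner's scheme.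
\<close>

definition poly_op :: "('a::real_vector \<Rightarrow> 'a) \<Rightarrow> real poly \<Rightarrow> 'a \<Rightarrow> 'a" where
  "poly_op R p x = fold_coeffs (\<lambda>a y. a *\<^sub>R x + R y) p 0"

text \<open>
  A bounded symmetric operator \<open>R\<close> with \<open>0 \<le> R \<le> 1\<close>. Real Hilbert spaces suffice here; complex linearity
  of the spectral projections will follow because they commute with every bounded operator that commutes
  with \<open>R\<close>.
\<close>

locale hilbert_contraction =
  fixes R :: "'a::{real_inner, complete_space} \<Rightarrow> 'a"
  assumes bounded_linear_R: "bounded_linear R"
    and symmetric: "inner (R x) y = inner x (R y)"
    and nonneg: "0 \<le> inner (R x) x"
    and le_id: "inner (R x) x \<le> inner x x"
begin

sublocale R: bounded_linear R
  by (rule bounded_linear_R)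

lemma poly_op_0 [simp]: "poly_op R 0 x = 0"
  by (simp add: poly_op_def)

lemma poly_op_pCons [simp]: "poly_op R (pCons a p) x = a *\<^sub>R x + R (poly_op R p x)"
  by (cases "p = 0 \<and> a = 0") (auto simp: poly_op_def R.zero)

lemma poly_op_1 [simp]: "poly_op R 1 x = x"
  by (simp add: one_pCons R.zero)

lemma poly_op_add: "poly_op R (p + q) x = poly_op R p x + poly_op R q x"
  by (induction p q rule: poly_induct2) (auto simp: R.add scaleR_add_left)

lemma poly_op_smult: "poly_op R (smult c p) x = c *\<^sub>R poly_op R p x"
  by (induction p) (auto simp: R.scaleR scaleR_add_right)

lemma poly_op_diff: "poly_op R (p - q) x = poly_op R p x - poly_op R q x"
  using poly_op_add[of p "- q" x] poly_op_smult[of "-1" q x] by simp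

lemma poly_op_mult: "poly_op R (p * q) x = poly_op R p (poly_op R q x)"
  by (induction p) (auto simp: poly_op_add poly_op_smult)

lemma poly_op_commute:
  assumes "linear U" "\<And>x. U (R x) = R (U x)"
  shows "poly_op R p (U x) = U (poly_op R p x)"
  by (induction p) (auto simp: assms linear_add linear_scale linear_0)

lemma poly_op_add_right: "poly_op R p (x + y) = poly_op R p x + poly_op R p y"
  by (induction p) (auto simp: R.add scaleR_add_right)

lemma poly_op_symmetric: "inner (poly_op R p x) y = inner x (poly_op R p y)"
proof (induction p arbitrary: x y)
  case (pCons a p)
  have "poly_op R p (R y) = R (poly_op R p y)" for y
    by (rule poly_op_commute) (auto intro: R.linear)
  then show ?case
    by (simp add: inner_add_left inner_add_right symmetric pCons)
qed simp

lemma poly_op_bernstein_nonneg: "0 \<le> inner (poly_op R ([:0, 1:] ^ k * [:1, -1:] ^ j) x) x"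
proof -
  let ?X = "[:0, 1::real:]" and ?Y = "[:1, -1::real:]"
  define pos where "pos p \<longleftrightarrow> (\<forall>x. 0 \<le> inner (poly_op R p x) x)" for p
  have pos_square: "pos (q * q * r)" if "pos r" for q r
  proof -
    have "inner (poly_op R (q * q * r) x) x = inner (poly_op R r (poly_op R q x)) (poly_op R q x)" for x
    proof -
      have "q * q * r = q * (r * q)"
        by (simp add: algebra_simps)
      then show ?thesis
        by (simp only: poly_op_mult poly_op_symmetric[of q])
    qed
    with that show ?thesis
      by (simp add: pos_def)
  qed
  have pos_add: "pos (p + q)" if "pos p" "pos q" for p q
    using that by (simp add: pos_def poly_op_add inner_add_left)
  have pos1: "pos 1" and posX: "pos ?X" and posY: "pos ?Y"
    using nonneg le_id by (auto simp: pos_def R.zero inner_diff_left R.neg)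
  have "?X * ?Y = ?X * ?X * ?Y + ?Y * ?Y * ?X"
    by simp
  then have posXY: "pos (?X * ?Y)"
    using pos_add[OF pos_square[OF posY] pos_square[OF posX]] by metis
  \<comment> \<open>After removal of the square factors, only the exponents modulo 2 matter.\<close>
  define a b where "a = k mod 2" and "b = j mod 2"
  have "a = 0 \<or> a = 1" "b = 0 \<or> b = 1"
    by (auto simp: a_def b_def)
  then have "pos (?X ^ a * ?Y ^ b)"
    using pos1 posX posY posXY
    by (elim disjE) (simp_all only: power_0 power_one_right mult_1_left mult_1_right)
  then have "pos ((?X ^ (k div 2) * ?Y ^ (j div 2)) * (?X ^ (k div 2) * ?Y ^ (j div 2)) * (?X ^ a * ?Y ^ b))"
    by (rule pos_square)
  also have "(?X ^ (k div 2) * ?Y ^ (j div 2)) * (?X ^ (k div 2) * ?Y ^ (j div 2)) * (?X ^ a * ?Y ^ b)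
      = ?X ^ (2 * (k div 2) + k mod 2) * ?Y ^ (2 * (j div 2) + j mod 2)"
    by (simp only: a_def b_def power_add mult_2 ac_simps)
  finally show ?thesis
    by (simp add: pos_def)
qed

lemma vector_measure_exists:
  "\<exists>M. unit_measure M \<and> (\<forall>p. inner (poly_op R p x) x = (\<integral>t. poly p t \<partial>M))"
proof -
  obtain M where "finite_measure M" "sets M = sets borel" "AE t in M. t \<in> {0..1}"
    "\<And>p. inner (poly_op R p x) x = (\<integral>t. poly p t \<partial>M)"
    by (rule hausdorff_moment_representation[of "\<lambda>p. inner (poly_op R p x) x"])
       (auto simp: poly_op_add poly_op_smult inner_add_left poly_op_bernstein_nonneg)
  then show ?thesis
    by (auto simp: unit_measure_def)
qed

text \<open>
  The spectral measure of the vector \<open>x\<close>: a measure whose moments are \<open>\<langle>R\<^sup>n x, x\<rangle>\<close>. It is merely chosen;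
  its uniqueness is never used.
\<close>

definition \<mu> :: "'a \<Rightarrow> real measure" where
  "\<mu> x = (SOME M. unit_measure M \<and> (\<forall>p. inner (poly_op R p x) x = (\<integral>t. poly p t \<partial>M)))"

lemma unit_measure_\<mu>: "unit_measure (\<mu> x)"
  and inner_poly_op: "inner (poly_op R p x) x = (\<integral>t. poly p t \<partial>\<mu> x)"
  using someI_ex[OF vector_measure_exists[of x]] unfolding \<mu>_def[symmetric] by blast+

lemmas integrable_\<mu> = integrable_bounded_borel[OF unit_measure_\<mu>]

lemma norm_poly_op: "(norm (poly_op R p x))\<^sup>2 = (\<integral>t. (poly p t)\<^sup>2 \<partial>\<mu> x)"
proof -
  have "(norm (poly_op R p x))\<^sup>2 = inner (poly_op R (p * p) x) x"
    by (simp add: power2_norm_eq_inner poly_op_mult poly_op_symmetric)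
  then show ?thesis
    by (simp add: inner_poly_op power2_eq_square)
qed

text \<open>
  \<open>represents g x y\<close> says that \<open>y = g(R) x\<close>: the isometry \<open>p \<mapsto> p(R) x\<close> from polynomials in \<open>L\<^sup>2(\<mu> x)\<close>, extended by
  continuity, sends \<open>g\<close> to \<open>y\<close>.
\<close>

definition represents :: "(real \<Rightarrow> real) \<Rightarrow> 'a \<Rightarrow> 'a \<Rightarrow> bool" where
  "represents g x y \<longleftrightarrow> (\<exists>p. (\<lambda>n. \<integral>t. (poly (p n) t - g t)\<^sup>2 \<partial>\<mu> x) \<longlonglongrightarrow> 0 \<and>
                           (\<lambda>n. poly_op R (p n) x) \<longlonglongrightarrow> y)"

lemma representsI:
  assumes "(\<lambda>n. \<integral>t. (poly (p n) t - g t)\<^sup>2 \<partial>\<mu> x) \<longlonglongrightarrow> 0" "(\<lambda>n. poly_op R (p n) x) \<longlonglongrightarrow> y"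
  shows "represents g x y"
  using assms unfolding represents_def by blast

lemma dist_poly_op_le:
  assumes g: "bounded_borel g"
  shows "(dist (poly_op R p x) (poly_op R q x))\<^sup>2
    \<le> 2 * (\<integral>t. (poly p t - g t)\<^sup>2 \<partial>\<mu> x) + 2 * (\<integral>t. (poly q t - g t)\<^sup>2 \<partial>\<mu> x)"
proof -
  have "(dist (poly_op R p x) (poly_op R q x))\<^sup>2 = (norm (poly_op R (p - q) x))\<^sup>2"
    by (simp add: dist_norm poly_op_diff)
  also have "\<dots> = (\<integral>t. (poly (p - q) t)\<^sup>2 \<partial>\<mu> x)"
    by (rule norm_poly_op)
  also have "\<dots> \<le> (\<integral>t. 2 * (poly p t - g t)\<^sup>2 + 2 * (poly q t - g t)\<^sup>2 \<partial>\<mu> x)"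
  proof (intro integral_mono integrable_\<mu> bounded_borel_intros g)
    fix t
    have "0 \<le> ((poly p t - g t) + (poly q t - g t))\<^sup>2"
      by simp
    then show "(poly (p - q) t)\<^sup>2 \<le> 2 * (poly p t - g t)\<^sup>2 + 2 * (poly q t - g t)\<^sup>2"
      by (simp add: power2_eq_square algebra_simps)
  qed
  also have "\<dots> = 2 * (\<integral>t. (poly p t - g t)\<^sup>2 \<partial>\<mu> x) + 2 * (\<integral>t. (poly q t - g t)\<^sup>2 \<partial>\<mu> x)"
    by (subst Bochner_Integration.integral_add) (auto intro!: integrable_\<mu> bounded_borel_intros g)
  finally show ?thesis .
qed

lemma represents_tendsto:
  assumes g: "bounded_borel g" and y: "represents g x y"
    and p: "(\<lambda>n. \<integral>t. (poly (p n) t - g t)\<^sup>2 \<partial>\<mu> x) \<longlonglongrightarrow> 0"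
  shows "(\<lambda>n. poly_op R (p n) x) \<longlonglongrightarrow> y"
proof -
  obtain q where q: "(\<lambda>n. \<integral>t. (poly (q n) t - g t)\<^sup>2 \<partial>\<mu> x) \<longlonglongrightarrow> 0"
    and qy: "(\<lambda>n. poly_op R (q n) x) \<longlonglongrightarrow> y"
    using y by (auto simp: represents_def)
  have "(\<lambda>n. (dist (poly_op R (p n) x) (poly_op R (q n) x))\<^sup>2) \<longlonglongrightarrow> 0"
    by (rule tendsto_zero_double_bound[OF _ p q]) (use dist_poly_op_le[OF g] in simp)
  then have "(\<lambda>n. norm (poly_op R (p n) x - poly_op R (q n) x)) \<longlonglongrightarrow> 0"
    by (simp add: dist_norm)
  from tendsto_add[OF tendsto_norm_zero_cancel[OF this] qy] show ?thesis
    by simp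
qed

lemma represents_unique:
  assumes "bounded_borel g" "represents g x y" "represents g x z"
  shows "y = z"
proof -
  obtain p where p: "(\<lambda>n. \<integral>t. (poly (p n) t - g t)\<^sup>2 \<partial>\<mu> x) \<longlonglongrightarrow> 0"
    using assms by (auto simp: represents_def)
  show ?thesis
    by (rule LIMSEQ_unique[OF represents_tendsto[OF assms(1,2) p] represents_tendsto[OF assms(1,3) p]])
qed

lemma represents_ex:
  assumes g: "bounded_borel g"
    and p: "(\<lambda>n. \<integral>t. (poly (p n) t - g t)\<^sup>2 \<partial>\<mu> x) \<longlonglongrightarrow> 0"
  shows "\<exists>y. represents g x y"
proof -
  have "Cauchy (\<lambda>n. poly_op R (p n) x)"
  proof (rule metric_CauchyI)
    fix e :: real assume "0 < e"
    obtain N where N: "\<And>n. n \<ge> N \<Longrightarrow> (\<integral>t. (poly (p n) t - g t)\<^sup>2 \<partial>\<mu> x) < e\<^sup>2 / 4"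
      using LIMSEQ_D[OF p, of "e\<^sup>2 / 4"] \<open>0 < e\<close> by auto
    show "\<exists>M. \<forall>m\<ge>M. \<forall>n\<ge>M. dist (poly_op R (p m) x) (poly_op R (p n) x) < e"
    proof (intro exI[of _ N] allI impI)
      fix m n assume "N \<le> m" "N \<le> n"
      have "(dist (poly_op R (p m) x) (poly_op R (p n) x))\<^sup>2
          \<le> 2 * (\<integral>t. (poly (p m) t - g t)\<^sup>2 \<partial>\<mu> x) + 2 * (\<integral>t. (poly (p n) t - g t)\<^sup>2 \<partial>\<mu> x)"
        by (rule dist_poly_op_le[OF g])
      also have "\<dots> < 2 * (e\<^sup>2 / 4) + 2 * (e\<^sup>2 / 4)"
        using N[OF \<open>N \<le> m\<close>] N[OF \<open>N \<le> n\<close>] by (intro add_strict_mono mult_strict_left_mono) simp_all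
      also have "\<dots> = e\<^sup>2"
        by simp
      finally show "dist (poly_op R (p m) x) (poly_op R (p n) x) < e"
        using \<open>0 < e\<close> by (rule power2_less_imp_less[OF _ less_imp_le])
    qed
  qed
  then obtain y where "(\<lambda>n. poly_op R (p n) x) \<longlonglongrightarrow> y"
    using Cauchy_convergent convergent_def by blast
  with p show ?thesis
    unfolding represents_def by blast
qed

lemma common_polynomials:
  assumes "finite X" "B \<in> sets borel"
  obtains p where "\<And>x. x \<in> X \<Longrightarrow> (\<lambda>n. \<integral>t. (poly (p n) t - indicator B t)\<^sup>2 \<partial>\<mu> x) \<longlonglongrightarrow> 0"
proof -
  have "\<exists>p. \<forall>x\<in>X. (\<integral>t. (poly p t - indicator B t)\<^sup>2 \<partial>\<mu> x) < inverse (real (Suc n))" for n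
    by (rule polynomials_dense_indicator[of X \<mu> B "inverse (real (Suc n))"])
       (use assms unit_measure_\<mu> in auto)
  then obtain p where p: "\<And>n x. x \<in> X \<Longrightarrow> (\<integral>t. (poly (p n) t - indicator B t)\<^sup>2 \<partial>\<mu> x) < inverse (real (Suc n))"
    by metis
  show ?thesis
  proof (rule that)
    fix x assume "x \<in> X"
    then show "(\<lambda>n. \<integral>t. (poly (p n) t - indicator B t)\<^sup>2 \<partial>\<mu> x) \<longlonglongrightarrow> 0"
      by (intro Lim_null_comparison[OF always_eventually LIMSEQ_inverse_real_of_nat])
         (use p in \<open>auto intro: less_imp_le\<close>)
  qed
qed

lemma represents_add:
  assumes g: "bounded_borel g" and h: "bounded_borel h"
    and "represents g x y" "represents h x z"
  shows "represents (\<lambda>t. g t + h t) x (y + z)"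
proof -
  obtain p q where p: "(\<lambda>n. \<integral>t. (poly (p n) t - g t)\<^sup>2 \<partial>\<mu> x) \<longlonglongrightarrow> 0" "(\<lambda>n. poly_op R (p n) x) \<longlonglongrightarrow> y"
    and q: "(\<lambda>n. \<integral>t. (poly (q n) t - h t)\<^sup>2 \<partial>\<mu> x) \<longlonglongrightarrow> 0" "(\<lambda>n. poly_op R (q n) x) \<longlonglongrightarrow> z"
    using assms by (auto simp: represents_def)
  have "(\<integral>t. (poly (p n + q n) t - (g t + h t))\<^sup>2 \<partial>\<mu> x)
      \<le> 2 * (\<integral>t. (poly (p n) t - g t)\<^sup>2 \<partial>\<mu> x) + 2 * (\<integral>t. (poly (q n) t - h t)\<^sup>2 \<partial>\<mu> x)" for n
  proof -
    have "(\<integral>t. (poly (p n + q n) t - (g t + h t))\<^sup>2 \<partial>\<mu> x)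
        \<le> (\<integral>t. 2 * (poly (p n) t - g t)\<^sup>2 + 2 * (poly (q n) t - h t)\<^sup>2 \<partial>\<mu> x)"
    proof (intro integral_mono integrable_\<mu> bounded_borel_intros g h)
      fix t
      have "0 \<le> ((poly (p n) t - g t) - (poly (q n) t - h t))\<^sup>2"
        by simp
      then show "(poly (p n + q n) t - (g t + h t))\<^sup>2 \<le> 2 * (poly (p n) t - g t)\<^sup>2 + 2 * (poly (q n) t - h t)\<^sup>2"
        by (simp add: power2_eq_square algebra_simps)
    qed
    also have "\<dots> = 2 * (\<integral>t. (poly (p n) t - g t)\<^sup>2 \<partial>\<mu> x) + 2 * (\<integral>t. (poly (q n) t - h t)\<^sup>2 \<partial>\<mu> x)"
      by (subst Bochner_Integration.integral_add) (auto intro!: integrable_\<mu> bounded_borel_intros g h)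
    finally show ?thesis .
  qed
  then have "(\<lambda>n. \<integral>t. (poly (p n + q n) t - (g t + h t))\<^sup>2 \<partial>\<mu> x) \<longlonglongrightarrow> 0"
    by (intro tendsto_zero_double_bound[OF _ p(1) q(1)]) simp
  moreover have "(\<lambda>n. poly_op R (p n + q n) x) \<longlonglongrightarrow> y + z"
    unfolding poly_op_add by (intro tendsto_add p q)
  ultimately show ?thesis
    by (rule representsI)
qed

lemma represents_cmult:
  assumes "represents g x y"
  shows "represents (\<lambda>t. c * g t) x (c *\<^sub>R y)"
proof -
  obtain p where p: "(\<lambda>n. \<integral>t. (poly (p n) t - g t)\<^sup>2 \<partial>\<mu> x) \<longlonglongrightarrow> 0" "(\<lambda>n. poly_op R (p n) x) \<longlonglongrightarrow> y"
    using assms by (auto simp: represents_def)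
  have "(\<lambda>n. c\<^sup>2 * (\<integral>t. (poly (p n) t - g t)\<^sup>2 \<partial>\<mu> x)) \<longlonglongrightarrow> c\<^sup>2 * 0"
    by (intro tendsto_intros p)
  moreover have "(\<integral>t. (poly (smult c (p n)) t - c * g t)\<^sup>2 \<partial>\<mu> x) = c\<^sup>2 * (\<integral>t. (poly (p n) t - g t)\<^sup>2 \<partial>\<mu> x)" for n
    by (simp flip: right_diff_distrib power_mult_distrib integral_mult_right_zero)
  ultimately have "(\<lambda>n. \<integral>t. (poly (smult c (p n)) t - c * g t)\<^sup>2 \<partial>\<mu> x) \<longlonglongrightarrow> 0"
    by simp
  moreover have "(\<lambda>n. poly_op R (smult c (p n)) x) \<longlonglongrightarrow> c *\<^sub>R y"
    unfolding poly_op_smult by (intro tendsto_intros p)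
  ultimately show ?thesis
    by (rule representsI)
qed

lemma represents_const: "represents (\<lambda>t. c) x (c *\<^sub>R x)"
  unfolding represents_def by (intro exI[of _ "\<lambda>n. [:c:]"]) (simp add: R.zero)

lemma represents_sum:
  assumes "finite I" "\<And>i. i \<in> I \<Longrightarrow> bounded_borel (g i)" "\<And>i. i \<in> I \<Longrightarrow> represents (g i) x (y i)"
  shows "bounded_borel (\<lambda>t. \<Sum>i\<in>I. g i t) \<and> represents (\<lambda>t. \<Sum>i\<in>I. g i t) x (\<Sum>i\<in>I. y i)"
  using assms
proof (induction I)
  case empty
  then show ?case
    using represents_const[of 0 x] by (simp add: bounded_borel_const)
next
  case (insert i I)
  then show ?case
    by (auto intro!: bounded_borel_add represents_add)
qed

lemma represents_mult_id:
  assumes g: "bounded_borel g" and "represents g x y"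
  shows "represents (\<lambda>t. t * g t) x (R y)"
proof -
  obtain p where p: "(\<lambda>n. \<integral>t. (poly (p n) t - g t)\<^sup>2 \<partial>\<mu> x) \<longlonglongrightarrow> 0" "(\<lambda>n. poly_op R (p n) x) \<longlonglongrightarrow> y"
    using assms by (auto simp: represents_def)
  have "(\<integral>t. (poly (pCons 0 (p n)) t - t * g t)\<^sup>2 \<partial>\<mu> x) \<le> (\<integral>t. (poly (p n) t - g t)\<^sup>2 \<partial>\<mu> x)" for n
  proof (rule integral_mono_AE)
    have "AE t in \<mu> x. t \<in> {0..1}"
      using unit_measure_\<mu>[of x] by (simp add: unit_measure_def)
    then show "AE t in \<mu> x. (poly (pCons 0 (p n)) t - t * g t)\<^sup>2 \<le> (poly (p n) t - g t)\<^sup>2"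
    proof eventually_elim
      fix t :: real assume t: "t \<in> {0..1}"
      have "(poly (pCons 0 (p n)) t - t * g t)\<^sup>2 = t\<^sup>2 * (poly (p n) t - g t)\<^sup>2"
        by (simp flip: right_diff_distrib power_mult_distrib)
      also have "\<dots> \<le> 1 * (poly (p n) t - g t)\<^sup>2"
        using t by (intro mult_right_mono) (auto simp: power_le_one)
      finally show "(poly (pCons 0 (p n)) t - t * g t)\<^sup>2 \<le> (poly (p n) t - g t)\<^sup>2"
        by simp
    qed
  qed (intro integrable_\<mu> bounded_borel_intros g)+
  then have "(\<lambda>n. \<integral>t. (poly (pCons 0 (p n)) t - t * g t)\<^sup>2 \<partial>\<mu> x) \<longlonglongrightarrow> 0"
    by (intro Lim_null_comparison[OF always_eventually p(1)]) auto
  moreover have "(\<lambda>n. poly_op R (pCons 0 (p n)) x) \<longlonglongrightarrow> R y"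
    using R.tendsto[OF p(2)] by simp
  ultimately show ?thesis
    by (rule representsI)
qed

lemma represents_inner_norm:
  assumes g: "bounded_borel g" and "represents g x y"
  shows "inner y x = (\<integral>t. g t \<partial>\<mu> x)" and "(norm y)\<^sup>2 = (\<integral>t. (g t)\<^sup>2 \<partial>\<mu> x)"
proof -
  obtain p where p: "(\<lambda>n. \<integral>t. (poly (p n) t - g t)\<^sup>2 \<partial>\<mu> x) \<longlonglongrightarrow> 0" "(\<lambda>n. poly_op R (p n) x) \<longlonglongrightarrow> y"
    using assms by (auto simp: represents_def)
  have mult: "(\<lambda>n. \<integral>t. (poly (p n) t - g t) * f t \<partial>\<mu> x) \<longlonglongrightarrow> 0" if "bounded_borel f" for f
    by (intro L2_tendsto_integral_mult[OF unit_measure_\<mu>] bounded_borel_intros g that p)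
  have "(\<lambda>n. inner (poly_op R (p n) x) x) \<longlonglongrightarrow> inner y x"
    by (intro tendsto_inner p tendsto_const)
  moreover have "(\<lambda>n. (\<integral>t. (poly (p n) t - g t) * 1 \<partial>\<mu> x) + (\<integral>t. g t \<partial>\<mu> x)) \<longlonglongrightarrow> 0 + (\<integral>t. g t \<partial>\<mu> x)"
    by (intro tendsto_add mult bounded_borel_intros tendsto_const)
  moreover have "inner (poly_op R (p n) x) x = (\<integral>t. (poly (p n) t - g t) * 1 \<partial>\<mu> x) + (\<integral>t. g t \<partial>\<mu> x)" for n
    by (subst Bochner_Integration.integral_add[symmetric])
       (auto intro!: integrable_\<mu> bounded_borel_intros g simp: inner_poly_op)
  ultimately show "inner y x = (\<integral>t. g t \<partial>\<mu> x)"
    by (auto intro: LIMSEQ_unique)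
  have "(\<lambda>n. (norm (poly_op R (p n) x))\<^sup>2) \<longlonglongrightarrow> (norm y)\<^sup>2"
    by (intro tendsto_intros p)
  moreover have "(\<lambda>n. (\<integral>t. (poly (p n) t - g t)\<^sup>2 \<partial>\<mu> x) + (\<integral>t. (poly (p n) t - g t) * (2 * g t) \<partial>\<mu> x)
      + (\<integral>t. (g t)\<^sup>2 \<partial>\<mu> x)) \<longlonglongrightarrow> 0 + 0 + (\<integral>t. (g t)\<^sup>2 \<partial>\<mu> x)"
    by (intro tendsto_add mult p bounded_borel_intros g tendsto_const)
  moreover have "(norm (poly_op R (p n) x))\<^sup>2 = (\<integral>t. (poly (p n) t - g t)\<^sup>2 \<partial>\<mu> x)
      + (\<integral>t. (poly (p n) t - g t) * (2 * g t) \<partial>\<mu> x) + (\<integral>t. (g t)\<^sup>2 \<partial>\<mu> x)" for n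
  proof -
    have "(norm (poly_op R (p n) x))\<^sup>2
        = (\<integral>t. (poly (p n) t - g t)\<^sup>2 + (poly (p n) t - g t) * (2 * g t) + (g t)\<^sup>2 \<partial>\<mu> x)"
      unfolding norm_poly_op by (intro Bochner_Integration.integral_cong) (auto simp: power2_eq_square algebra_simps)
    also have "\<dots> = (\<integral>t. (poly (p n) t - g t)\<^sup>2 + (poly (p n) t - g t) * (2 * g t) \<partial>\<mu> x) + (\<integral>t. (g t)\<^sup>2 \<partial>\<mu> x)"
      by (intro Bochner_Integration.integral_add integrable_\<mu> bounded_borel_intros g)
    also have "(\<integral>t. (poly (p n) t - g t)\<^sup>2 + (poly (p n) t - g t) * (2 * g t) \<partial>\<mu> x)
        = (\<integral>t. (poly (p n) t - g t)\<^sup>2 \<partial>\<mu> x) + (\<integral>t. (poly (p n) t - g t) * (2 * g t) \<partial>\<mu> x)"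
      by (intro Bochner_Integration.integral_add integrable_\<mu> bounded_borel_intros g)
    finally show ?thesis .
  qed
  ultimately show "(norm y)\<^sup>2 = (\<integral>t. (g t)\<^sup>2 \<partial>\<mu> x)"
    by (auto intro: LIMSEQ_unique)
qed

text \<open>
  The spectral projections of \<open>R\<close>. On non-Borel sets the value is irrelevant.
\<close>

definition E :: "real set \<Rightarrow> 'a \<Rightarrow> 'a" where
  "E B x = (THE y. represents (indicator B) x y)"

lemma represents_E:
  assumes B: "B \<in> sets borel"
  shows "represents (indicator B) x (E B x)"
proof -
  obtain p where "\<And>z. z \<in> {x} \<Longrightarrow> (\<lambda>n. \<integral>t. (poly (p n) t - indicator B t)\<^sup>2 \<partial>\<mu> z) \<longlonglongrightarrow> 0"
    using common_polynomials[of "{x}" B] B by blast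
  then obtain y where y: "represents (indicator B) x y"
    using represents_ex[OF bounded_borel_indicator[OF B], where p = p and x = x] by auto
  then have "E B x = y"
    unfolding E_def using represents_unique[OF bounded_borel_indicator[OF B]] by (intro the_equality)
  with y show ?thesis
    by simp
qed

lemma E_eqI: "B \<in> sets borel \<Longrightarrow> represents (indicator B) x y \<Longrightarrow> E B x = y"
  using represents_unique[OF bounded_borel_indicator] represents_E by blast

lemma E_tendsto:
  assumes "B \<in> sets borel" "(\<lambda>n. \<integral>t. (poly (p n) t - indicator B t)\<^sup>2 \<partial>\<mu> x) \<longlonglongrightarrow> 0"
  shows "(\<lambda>n. poly_op R (p n) x) \<longlonglongrightarrow> E B x"
  using represents_tendsto[OF bounded_borel_indicator represents_E] assms by blast

lemma E_add:
  assumes B: "B \<in> sets borel"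
  shows "E B (x + y) = E B x + E B y"
proof -
  obtain p where p: "\<And>z. z \<in> {x, y, x + y} \<Longrightarrow> (\<lambda>n. \<integral>t. (poly (p n) t - indicator B t)\<^sup>2 \<partial>\<mu> z) \<longlonglongrightarrow> 0"
    using common_polynomials[of "{x, y, x + y}" B] B by blast
  have "(\<lambda>n. poly_op R (p n) x + poly_op R (p n) y) \<longlonglongrightarrow> E B x + E B y"
    by (intro tendsto_add E_tendsto B p) auto
  moreover have "(\<lambda>n. poly_op R (p n) (x + y)) \<longlonglongrightarrow> E B (x + y)"
    by (intro E_tendsto B p) auto
  ultimately show ?thesis
    unfolding poly_op_add_right by (rule LIMSEQ_unique[rotated])
qed

lemma E_commute:
  assumes B: "B \<in> sets borel" and U: "bounded_linear U" "\<And>x. U (R x) = R (U x)"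
  shows "E B (U x) = U (E B x)"
proof -
  obtain p where p: "\<And>z. z \<in> {x, U x} \<Longrightarrow> (\<lambda>n. \<integral>t. (poly (p n) t - indicator B t)\<^sup>2 \<partial>\<mu> z) \<longlonglongrightarrow> 0"
    using common_polynomials[of "{x, U x}" B] B by blast
  have "(\<lambda>n. U (poly_op R (p n) x)) \<longlonglongrightarrow> U (E B x)"
    by (intro bounded_linear.tendsto[OF U(1)] E_tendsto B p) auto
  moreover have "(\<lambda>n. poly_op R (p n) (U x)) \<longlonglongrightarrow> E B (U x)"
    by (intro E_tendsto B p) auto
  ultimately show ?thesis
    unfolding poly_op_commute[OF bounded_linear.linear[OF U(1)] U(2)] by (rule LIMSEQ_unique[rotated])
qed

lemma E_R: "B \<in> sets borel \<Longrightarrow> E B (R x) = R (E B x)"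
  by (rule E_commute) (auto intro: bounded_linear_R)

lemma E_symmetric:
  assumes B: "B \<in> sets borel"
  shows "inner (E B x) y = inner x (E B y)"
proof -
  obtain p where p: "\<And>z. z \<in> {x, y} \<Longrightarrow> (\<lambda>n. \<integral>t. (poly (p n) t - indicator B t)\<^sup>2 \<partial>\<mu> z) \<longlonglongrightarrow> 0"
    using common_polynomials[of "{x, y}" B] B by blast
  have "(\<lambda>n. inner (poly_op R (p n) x) y) \<longlonglongrightarrow> inner (E B x) y"
    by (intro tendsto_inner tendsto_const E_tendsto B p) auto
  moreover have "(\<lambda>n. inner x (poly_op R (p n) y)) \<longlonglongrightarrow> inner x (E B y)"
    by (intro tendsto_inner tendsto_const E_tendsto B p) auto
  ultimately show ?thesis
    unfolding poly_op_symmetric by (rule LIMSEQ_unique)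
qed

lemma space_\<mu>: "space (\<mu> x) = UNIV" and sets_\<mu>: "sets (\<mu> x) = sets borel"
  using unit_measure_\<mu>[of x] sets_eq_imp_space_eq[of "\<mu> x" borel] by (auto simp: unit_measure_def)

lemma inner_E: "B \<in> sets borel \<Longrightarrow> inner (E B x) x = measure (\<mu> x) B"
  and norm_E: "B \<in> sets borel \<Longrightarrow> (norm (E B x))\<^sup>2 = measure (\<mu> x) B"
proof -
  assume B: "B \<in> sets borel"
  have "(\<lambda>t. (indicator B t)\<^sup>2) = (indicator B :: real \<Rightarrow> real)"
    by (auto simp: indicator_def)
  then show "inner (E B x) x = measure (\<mu> x) B" "(norm (E B x))\<^sup>2 = measure (\<mu> x) B"
    using represents_inner_norm[OF bounded_borel_indicator[OF B] represents_E[OF B], of x] B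
    by (auto simp: space_\<mu>)
qed

lemma E_idem:
  assumes B: "B \<in> sets borel"
  shows "E B (E B x) = E B x"
proof -
  define d where "d = E B (E B x) - E B x"
  have diff: "E B (x - y) = E B x - E B y" for x y
    using E_add[OF B, of "x - y" y] by (simp add: algebra_simps)
  have quad: "inner (E B (E B z)) z = inner (E B z) z" for z
    using inner_E[OF B, of z] norm_E[OF B, of z] by (simp add: E_symmetric[OF B] power2_norm_eq_inner)
  have sym1: "inner (E B d) x = inner (E B x) d"
    by (metis E_symmetric[OF B] inner_commute)
  have sym2: "inner (E B (E B d)) x = inner (E B (E B x)) d"
    by (metis E_symmetric[OF B] inner_commute)
  have "inner (E B (E B (x + d))) (x + d) = inner (E B (x + d)) (x + d)"
    by (rule quad)
  then have "2 * inner (E B (E B x)) d = 2 * inner (E B x) d"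
    using quad[of x] quad[of d] sym1 sym2
    by (simp add: E_add[OF B] inner_add_left inner_add_right)
  then have "inner d d = 0"
    by (simp add: d_def inner_diff_left)
  then show ?thesis
    by (simp add: d_def)
qed

lemma E_UNIV: "E UNIV x = x"
  using represents_const[of 1 x] by (intro E_eqI) auto

lemma E_sums:
  assumes F: "range F \<subseteq> sets borel" "disjoint_family F"
  shows "(\<lambda>n. E (F n) x) sums E (\<Union>n. F n) x"
proof -
  have FB: "F n \<in> sets borel" for n
    using F by auto
  then have UB: "(\<Union>n. F n) \<in> sets borel"
    by auto
  define h :: "nat \<Rightarrow> real \<Rightarrow> real" where "h n t = indicator (\<Union>n. F n) t + (-1) * (\<Sum>k<n. indicator (F k) t)" for n and t :: real
  have bounded_sum: "bounded_borel (\<lambda>t. \<Sum>k<n. indicator (F k) t)"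
    and rep_sum: "represents (\<lambda>t. \<Sum>k<n. indicator (F k) t) x (\<Sum>k<n. E (F k) x)" for n
    using represents_sum[of "{..<n}" "\<lambda>k. indicator (F k)" x "\<lambda>k. E (F k) x"]
    by (auto intro: bounded_borel_indicator represents_E FB)
  have h: "bounded_borel (h n)" for n
    unfolding h_def by (intro bounded_borel_intros bounded_sum UB)
  have "represents (h n) x (E (\<Union>n. F n) x + (-1) *\<^sub>R (\<Sum>k<n. E (F k) x))" for n
    unfolding h_def
    by (intro represents_add represents_cmult represents_E UB rep_sum bounded_borel_intros bounded_sum)
  then have norm_h: "(norm (E (\<Union>n. F n) x - (\<Sum>k<n. E (F k) x)))\<^sup>2 = (\<integral>t. (h n t)\<^sup>2 \<partial>\<mu> x)" for n
    using represents_inner_norm(2)[OF h] by fastforce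
  have sum_eq: "(\<Sum>k<n. indicator (F k) t) = (indicator (\<Union>k<n. F k) t :: real)" for n t
    using F(2) by (subst indicator_UN_disjoint) (auto intro: disjoint_family_on_mono)
  have h_eq: "h n t = indicator ((\<Union>n. F n) - (\<Union>k<n. F k)) t" for n t
    unfolding h_def sum_eq by (auto simp: indicator_def)
  have "(\<lambda>n. \<integral>t. (h n t)\<^sup>2 \<partial>\<mu> x) \<longlonglongrightarrow> (\<integral>t. 0 \<partial>\<mu> x)"
  proof (rule integral_dominated_convergence[where w = "\<lambda>_. 1"])
    show "AE t in \<mu> x. (\<lambda>n. (h n t)\<^sup>2) \<longlonglongrightarrow> 0"
    proof (intro AE_I2)
      fix t
      have "eventually (\<lambda>n. (h n t)\<^sup>2 = 0) sequentially"
      proof (cases "t \<in> (\<Union>n. F n)")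
        case True
        then obtain m where "t \<in> F m"
          by blast
        then have "(h n t)\<^sup>2 = 0" if "n > m" for n
          using that by (auto simp: h_eq indicator_def)
        then show ?thesis
          by (rule eventually_mono[OF eventually_gt_at_top[of m]])
      qed (simp add: h_eq)
      then show "(\<lambda>n. (h n t)\<^sup>2) \<longlonglongrightarrow> 0"
        by (rule tendsto_eventually)
    qed
    show "(\<lambda>t. (h n t)\<^sup>2) \<in> borel_measurable (\<mu> x)" for n
      by (intro borel_measurable_integrable integrable_\<mu> bounded_borel_intros h)
  qed (auto simp: h_eq indicator_def intro!: integrable_\<mu> bounded_borel_intros)
  then have "(\<lambda>n. (norm (E (\<Union>n. F n) x - (\<Sum>k<n. E (F k) x)))\<^sup>2) \<longlonglongrightarrow> 0"
    by (simp add: norm_h)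
  then have "(\<lambda>n. E (\<Union>n. F n) x - (\<Sum>k<n. E (F k) x)) \<longlonglongrightarrow> 0"
    by (simp add: tendsto_norm_zero_iff)
  from tendsto_diff[OF tendsto_const[of "E (\<Union>n. F n) x"] this] show ?thesis
    by (simp add: sums_def)
qed

lemma represents_simple:
  assumes V: "finite V" "\<And>t. s t \<in> V" and s: "s \<in> borel_measurable borel"
  shows "represents s x (\<Sum>v\<in>V. v *\<^sub>R E (s -` {v}) x)" and "bounded_borel s"
proof -
  have B: "s -` {v} \<in> sets borel" for v
    using measurable_sets[OF s, of "{v}"] by simp
  have eq: "(\<lambda>t. \<Sum>v\<in>V. v * indicator (s -` {v}) t) = s"
  proof
    fix t
    have "(\<Sum>v\<in>V. v * indicator (s -` {v}) t) = (\<Sum>v\<in>{s t}. v * indicator (s -` {v}) t)"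
      using V by (intro sum.mono_neutral_right) (auto simp: indicator_def)
    then show "(\<Sum>v\<in>V. v * indicator (s -` {v}) t) = s t"
      by simp
  qed
  have "bounded_borel (\<lambda>t. \<Sum>v\<in>V. v * indicator (s -` {v}) t)
      \<and> represents (\<lambda>t. \<Sum>v\<in>V. v * indicator (s -` {v}) t) x (\<Sum>v\<in>V. v *\<^sub>R E (s -` {v}) x)"
    by (intro represents_sum V represents_cmult represents_E bounded_borel_intros B)
  then show "represents s x (\<Sum>v\<in>V. v *\<^sub>R E (s -` {v}) x)" "bounded_borel s"
    by (simp_all add: eq)
qed

text \<open>
  The spectral measure of \<open>R x\<close> has density \<open>t\<^sup>2\<close> with respect to that of \<open>x\<close>.
\<close>

lemma measure_\<mu>_R:
  assumes B: "B \<in> sets borel"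
  shows "measure (\<mu> (R x)) B = (\<integral>t. (t * indicator B t)\<^sup>2 \<partial>\<mu> x)"
  using represents_inner_norm(2)[OF _ represents_mult_id[OF _ represents_E[OF B]], of x]
  by (simp add: bounded_borel_intros B E_R flip: norm_E)

lemma measure_\<mu>_0:
  assumes "inj R"
  shows "measure (\<mu> x) {0} = 0"
proof -
  have "(norm (R (E {0} x)))\<^sup>2 = (\<integral>t. (t * indicator {0} t)\<^sup>2 \<partial>\<mu> x)"
    using represents_inner_norm(2)[OF _ represents_mult_id[OF _ represents_E[of "{0}"]], of x]
    by (simp add: bounded_borel_intros)
  also have "(\<lambda>t. (t * indicator {0} t)\<^sup>2) = (\<lambda>t::real. 0::real)"
    by (auto simp: indicator_def)
  finally have "R (E {0} x) = R 0"
    by (simp add: R.zero)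
  then have "E {0} x = 0"
    using assms by (rule injD[rotated])
  then show ?thesis
    by (simp flip: norm_E)
qed

end


section \<open>Integration with respect to a spectral measure\<close>

lemma scaleC_zero_right [simp]: "a *\<^sub>C (0 :: 'a::complex_inner) = 0"
  using scaleC_add_right[of a 0 "0 :: 'a"] by simp

lemma scaleC_zero_left [simp]: "0 *\<^sub>C (x :: 'a::complex_inner) = 0"
  using scaleC_of_real[of 0 x] by simp

lemma scaleC_one [simp]: "1 *\<^sub>C (x :: 'a::complex_inner) = x"
  using scaleC_of_real[of 1 x] by simp

lemma scaleC_minus_left: "(- a) *\<^sub>C (x :: 'a::complex_inner) = - (a *\<^sub>C x)"
  using scaleC_add_left[of "- a" a x] by (simp add: add_eq_0_iff2)

lemma scaleC_diff_left: "(a - b) *\<^sub>C (x :: 'a::complex_inner) = a *\<^sub>C x - b *\<^sub>C x"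
  using scaleC_add_left[of a "- b" x] by (simp add: scaleC_minus_left)

lemma scaleC_diff_right: "a *\<^sub>C (x - y :: 'a::complex_inner) = a *\<^sub>C x - a *\<^sub>C y"
  using scaleC_add_right[of a "x - y" y] by (simp add: algebra_simps)

lemma scaleC_sum_right: "a *\<^sub>C (\<Sum>i\<in>I. f i :: 'a::complex_inner) = (\<Sum>i\<in>I. a *\<^sub>C f i)"
  by (induction I rule: infinite_finite_induct) (auto simp: scaleC_add_right)

lemma cinner_scaleC_right: "cinner x (a *\<^sub>C y) = cnj a * cinner (x :: 'a::complex_inner) y"
  by (metis cinner_commute cinner_scaleC_left complex_cnj_mult)

text \<open>
  The complex inner product is determined by the real one, so that limits and identities can be
  transferred between them.
\<close>

lemma Im_cinner: "Im (cinner (x :: 'a::complex_inner) y) = inner x (\<i> *\<^sub>C y)"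
  by (simp add: cinner_scaleC_right flip: Re_cinner)

lemma cinner_eq_iff_inner:
  "cinner (x :: 'a::complex_inner) y = cinner u v \<longleftrightarrow> inner x y = inner u v \<and> inner x (\<i> *\<^sub>C y) = inner u (\<i> *\<^sub>C v)"
  by (simp add: complex_eq_iff Re_cinner Im_cinner)

lemma cinner_self: "cinner (x :: 'a::complex_inner) x = complex_of_real ((norm x)\<^sup>2)"
proof -
  have "Im (cinner x x) = 0"
    using arg_cong[OF cinner_commute[of x x], of Im] by simp
  then show ?thesis
    by (simp add: complex_eq_iff Re_cinner power2_norm_eq_inner)
qed

lemma cinner_zero_left [simp]: "cinner (0 :: 'a::complex_inner) y = 0"
  using cinner_scaleC_left[of 0 0 y] by simp

lemma cinner_zero_right [simp]: "cinner (x :: 'a::complex_inner) 0 = 0"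
  using cinner_commute[of x 0] by simp

lemma norm_scaleC: "norm (a *\<^sub>C (x :: 'a::complex_inner)) = cmod a * norm x"
proof -
  have "complex_of_real ((norm (a *\<^sub>C x))\<^sup>2) = (a * cnj a) * cinner x x"
    by (simp only: cinner_self[symmetric] cinner_scaleC_left cinner_scaleC_right mult.assoc mult.left_commute)
  also have "\<dots> = complex_of_real ((cmod a)\<^sup>2) * complex_of_real ((norm x)\<^sup>2)"
    by (simp only: complex_norm_square cinner_self)
  also have "\<dots> = complex_of_real ((cmod a * norm x)\<^sup>2)"
    by (simp add: power_mult_distrib)
  finally show ?thesis
    by (simp only: of_real_eq_iff power2_eq_iff_nonneg norm_ge_zero mult_nonneg_nonneg)
qed

lemma bounded_linear_scaleC: "bounded_linear (\<lambda>x :: 'a::complex_inner. a *\<^sub>C x)"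
proof (rule bounded_linear_intro[where K = "cmod a"])
  fix r :: real and x :: 'a
  show "a *\<^sub>C (r *\<^sub>R x) = r *\<^sub>R (a *\<^sub>C x)"
    by (simp add: scaleC_scaleC mult.commute flip: scaleC_of_real)
qed (auto simp: scaleC_add_right norm_scaleC)

lemma tendsto_cinner_right:
  assumes "f \<longlonglongrightarrow> l"
  shows "(\<lambda>n. cinner w (f n)) \<longlonglongrightarrow> cinner (w :: 'a::complex_inner) l"
proof -
  have eq: "cinner w v = Complex (inner w v) (inner w (\<i> *\<^sub>C v))" for v
    by (simp add: complex_eq_iff Re_cinner Im_cinner)
  show ?thesis
    unfolding eq
    by (intro tendsto_Complex tendsto_inner tendsto_const assms bounded_linear.tendsto[OF bounded_linear_scaleC])
qed

lemma cinner_add_right: "cinner (x :: 'a::complex_inner) (y + z) = cinner x y + cinner x z"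
  by (metis cinner_commute cinner_add_left complex_cnj_add)

lemma cinner_diff_left: "cinner (x - y :: 'a::complex_inner) z = cinner x z - cinner y z"
  using cinner_add_left[of "x - y" y z] by simp

lemma cinner_diff_right: "cinner (x :: 'a::complex_inner) (y - z) = cinner x y - cinner x z"
  using cinner_add_right[of x "y - z" z] by simp

lemma cinner_scaleR_left: "cinner (r *\<^sub>R x :: 'a::complex_inner) y = complex_of_real r * cinner x y"
  by (simp add: cinner_scaleC_left flip: scaleC_of_real)

lemma cinner_scaleR_right: "cinner (x :: 'a::complex_inner) (r *\<^sub>R y) = complex_of_real r * cinner x y"
  by (simp add: cinner_scaleC_right flip: scaleC_of_real)

lemma ennreal_norm_add_le:
  "ennreal ((norm (x + y :: 'b::real_normed_vector))\<^sup>2) \<le> 2 * ennreal ((norm x)\<^sup>2) + 2 * ennreal ((norm y)\<^sup>2)"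
proof -
  have "(norm (x + y))\<^sup>2 \<le> (norm x + norm y)\<^sup>2"
    by (intro power_mono norm_triangle_ineq) simp
  also have "\<dots> \<le> 2 * (norm x)\<^sup>2 + 2 * (norm y)\<^sup>2"
    using zero_le_power2[of "norm x - norm y"] by (simp add: power2_eq_square algebra_simps)
  finally have "ennreal ((norm (x + y))\<^sup>2) \<le> ennreal (2 * (norm x)\<^sup>2 + 2 * (norm y)\<^sup>2)"
    by (rule ennreal_leI)
  then show ?thesis
    by (simp add: ennreal_plus ennreal_mult)
qed

lemma ennreal_double_bound_tendsto:
  fixes a :: "nat \<Rightarrow> real" and b c :: "nat \<Rightarrow> ennreal"
  assumes "\<And>n. ennreal (a n) \<le> 2 * b n + 2 * c n" "b \<longlonglongrightarrow> 0" "c \<longlonglongrightarrow> 0" "\<And>n. 0 \<le> a n"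
  shows "a \<longlonglongrightarrow> 0"
proof -
  have "(\<lambda>n. 2 * b n + 2 * c n) \<longlonglongrightarrow> 2 * 0 + 2 * 0"
    by (intro tendsto_add ennreal_tendsto_cmult assms) auto
  then have lim: "(\<lambda>n. 2 * b n + 2 * c n) \<longlonglongrightarrow> 0"
    by simp
  have "(\<lambda>n. ennreal (a n)) \<longlonglongrightarrow> 0"
    by (rule tendsto_sandwich[OF _ _ tendsto_const lim]) (auto simp: assms(1))
  then have "(\<lambda>n. ennreal (a n)) \<longlonglongrightarrow> ennreal 0"
    by simp
  then show ?thesis
    using assms(4) by (subst (asm) tendsto_ennreal_iff) auto
qed

lemma ennreal_norm_tendsto_zero:
  fixes a :: "nat \<Rightarrow> 'b::real_normed_vector"
  assumes "\<And>n. ennreal ((norm (a n))\<^sup>2) \<le> e n" "e \<longlonglongrightarrow> 0"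
  shows "a \<longlonglongrightarrow> 0"
proof -
  have "(\<lambda>n. ennreal ((norm (a n))\<^sup>2)) \<longlonglongrightarrow> 0"
    by (rule tendsto_sandwich[OF _ _ tendsto_const assms(2)]) (auto simp: assms(1))
  then have "(\<lambda>n. ennreal ((norm (a n))\<^sup>2)) \<longlonglongrightarrow> ennreal 0"
    by simp
  then have "(\<lambda>n. (norm (a n))\<^sup>2) \<longlonglongrightarrow> 0"
    by (subst (asm) tendsto_ennreal_iff) auto
  then show ?thesis
    by (simp add: tendsto_norm_zero_iff)
qed

text \<open>
  The setting of an arbitrary spectral measure; the predicate is made into a locale to name its parts.
\<close>

locale projection_valued_measure =
  fixes E :: "real set \<Rightarrow> 'a::chilbert_space \<Rightarrow> 'a"
  assumes spectral_measure_E: "spectral_measure E"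
begin

lemma E_add: "B \<in> sets borel \<Longrightarrow> E B (x + y) = E B x + E B y"
  and E_scaleC: "B \<in> sets borel \<Longrightarrow> E B (a *\<^sub>C x) = a *\<^sub>C E B x"
  and E_idem: "B \<in> sets borel \<Longrightarrow> E B (E B x) = E B x"
  and E_symmetric: "B \<in> sets borel \<Longrightarrow> cinner (E B x) y = cinner x (E B y)"
  and E_UNIV: "E UNIV x = x"
  and E_sums: "range F \<subseteq> sets borel \<Longrightarrow> disjoint_family F \<Longrightarrow> (\<lambda>n::nat. E (F n) x) sums E (\<Union>n. F n) x"
  using spectral_measure_E unfolding spectral_measure_def orth_projection_def by blast+

lemma E_inner_symmetric: "B \<in> sets borel \<Longrightarrow> inner (E B x) y = inner x (E B y)"
  using E_symmetric by (simp flip: Re_cinner)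

lemma inner_E_self: "B \<in> sets borel \<Longrightarrow> inner (E B x) x = (norm (E B x))\<^sup>2"
  by (simp add: power2_norm_eq_inner E_inner_symmetric E_idem)

lemma norm_E_le:
  assumes "B \<in> sets borel"
  shows "norm (E B x) \<le> norm x"
proof -
  have "(norm (E B x))\<^sup>2 \<le> norm (E B x) * norm x"
    using norm_cauchy_schwarz[of "E B x" x] assms by (simp add: inner_E_self)
  then show ?thesis
    by (cases "norm (E B x) = 0") (auto simp: power2_eq_square)
qed

lemma E_zero_right: "B \<in> sets borel \<Longrightarrow> E B 0 = 0"
  using E_scaleC[of B 0 0] by simp

lemma bounded_linear_E:
  assumes "B \<in> sets borel"
  shows "bounded_linear (E B)"
proof (rule bounded_linear_intro[where K = 1])
  show "E B (r *\<^sub>R x) = r *\<^sub>R E B x" for r x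
    using E_scaleC[OF assms, of "complex_of_real r" x] by (simp add: scaleC_of_real)
qed (use assms norm_E_le in \<open>auto simp: E_add\<close>)

lemma E_empty: "E {} x = 0"
proof -
  have "(\<lambda>n::nat. E {} x) sums E {} x"
    using E_sums[of "\<lambda>_. {}" x] by (auto simp: disjoint_family_on_def)
  then have "(\<lambda>n::nat. E {} x) \<longlonglongrightarrow> 0"
    by (intro summable_LIMSEQ_zero sums_summable)
  then show ?thesis
    by (simp add: LIMSEQ_const_iff)
qed

lemma E_Un:
  assumes "A \<in> sets borel" "B \<in> sets borel" "A \<inter> B = {}"
  shows "E (A \<union> B) x = E A x + E B x"
proof -
  have "(\<lambda>n. E (binaryset A B n) x) sums E (\<Union>n. binaryset A B n) x"
    using assms by (intro E_sums) (auto simp: binaryset_def disjoint_family_on_def)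
  moreover have "(\<lambda>n. E (binaryset A B n) x) sums (E A x + E B x)"
    by (intro binaryset_sums E_empty)
  ultimately show ?thesis
    unfolding UN_binaryset_eq by (rule sums_unique2)
qed

lemma E_finite_UN:
  assumes "finite I" "\<And>i. i \<in> I \<Longrightarrow> F i \<in> sets borel" "disjoint_family_on F I"
  shows "E (\<Union>i\<in>I. F i) x = (\<Sum>i\<in>I. E (F i) x)"
  using assms
proof (induction I)
  case (insert i I)
  have "F i \<inter> (\<Union>i\<in>I. F i) = {}"
    using insert.prems(2) insert.hyps(2) by (auto simp: disjoint_family_on_def)
  moreover have "disjoint_family_on F I"
    using insert.prems(2) by (auto simp: disjoint_family_on_def)
  moreover have "(\<Union>i\<in>I. F i) \<in> sets borel"
    using insert by (intro sets.finite_UN) auto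
  ultimately show ?case
    using insert by (simp add: E_Un)
qed (simp add: E_empty)

lemma E_disjoint:
  assumes A: "A \<in> sets borel" and B: "B \<in> sets borel" and disj: "A \<inter> B = {}"
  shows "E A (E B x) = 0"
proof -
  \<comment> \<open>The sum of two projections is a projection only if they anticommute; this forces their product to vanish.\<close>
  have anti: "E A (E B y) = - E B (E A y)" for y
  proof -
    have "E (A \<union> B) (E (A \<union> B) y) = E (A \<union> B) y"
      using A B by (intro E_idem) auto
    then show ?thesis
      by (simp add: E_Un[OF A B disj] E_add A B E_idem add_eq_0_iff2 algebra_simps)
  qed
  have minus: "E A (- y) = - E A y" for y
    using E_add[OF A, of y "- y"] by (simp add: E_zero_right A add_eq_0_iff2 minus_unique)
  have "E A (E B x) = - E A (E B (E A x))"
    using anti[of x] minus A B by (metis E_idem)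
  moreover have "E A (E B (E A x)) = - E B (E A x)"
    using anti[of "E A x"] by (simp add: E_idem A)
  ultimately have "E A (E B x) = E B (E A x)"
    by simp
  with anti[of x] have "E A (E B x) + E A (E B x) = 0"
    by (metis add.right_inverse)
  then have "2 *\<^sub>R E A (E B x) = 0"
    by (simp only: scaleR_2)
  then show ?thesis
    by simp
qed

lemma sets_scalar_measure [measurable_cong, simp]: "sets (scalar_measure E x) = sets borel"
  and space_scalar_measure [simp]: "space (scalar_measure E x) = UNIV"
  unfolding scalar_measure_def
  by (auto simp: sets.sigma_sets_eq[of borel, simplified])

lemma emeasure_scalar_measure:
  assumes B: "B \<in> sets borel"
  shows "emeasure (scalar_measure E x) B = ennreal ((norm (E B x))\<^sup>2)"
proof -
  have "emeasure (scalar_measure E x) B = ennreal (Re (cinner (E B x) x))"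
  proof (rule emeasure_measure_of[OF scalar_measure_def])
    show "positive (sets (scalar_measure E x)) (\<lambda>B. ennreal (Re (cinner (E B x) x)))"
      by (simp add: positive_def E_empty)
    show "countably_additive (sets (scalar_measure E x)) (\<lambda>B. ennreal (Re (cinner (E B x) x)))"
    proof (rule countably_additiveI)
      fix F :: "nat \<Rightarrow> real set"
      assume F: "range F \<subseteq> sets (scalar_measure E x)" "disjoint_family F"
      then have "(\<lambda>n. inner (E (F n) x) x) sums inner (E (\<Union>n. F n) x) x"
        by (intro bounded_linear.sums[OF bounded_linear_inner_left] E_sums) auto
      moreover have "0 \<le> inner (E (F n) x) x" for n
        using F by (subst inner_E_self) auto
      ultimately show "(\<Sum>n. ennreal (Re (cinner (E (F n) x) x))) = ennreal (Re (cinner (E (\<Union>n. F n) x) x))"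
        by (simp add: Re_cinner suminf_ennreal_eq sums_iff)
    qed
  qed (use B in auto)
  also have "Re (cinner (E B x) x) = (norm (E B x))\<^sup>2"
    using B by (simp add: Re_cinner inner_E_self)
  finally show ?thesis .
qed

text \<open>
  The integral of a simple function can be computed over any finer partition. Applied to the pair of two
  simple functions, this gives additivity.
\<close>

lemma simple_spectral_integral_compose:
  assumes g: "simple_function borel g"
  shows "simple_spectral_integral E (\<lambda>t. h (g t)) x = (\<Sum>v\<in>range g. h v *\<^sub>C E (g -` {v}) x)"
proof -
  have fin: "finite (range g)" and B: "g -` {v} \<in> sets borel" for v
    using simple_functionD[OF g] by auto
  have "simple_spectral_integral E (\<lambda>t. h (g t)) x
      = (\<Sum>c\<in>h ` range g. c *\<^sub>C E ((\<lambda>t. h (g t)) -` {c}) x)"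
    unfolding simple_spectral_integral_def by (simp add: image_image)
  also have "\<dots> = (\<Sum>c\<in>h ` range g. \<Sum>v\<in>{v\<in>range g. h v = c}. h v *\<^sub>C E (g -` {v}) x)"
  proof (rule sum.cong[OF refl])
    fix c
    have "(\<lambda>t. h (g t)) -` {c} = (\<Union>v\<in>{v\<in>range g. h v = c}. g -` {v})"
      by auto
    also have "E \<dots> x = (\<Sum>v\<in>{v\<in>range g. h v = c}. E (g -` {v}) x)"
      using fin B by (intro E_finite_UN) (auto simp: disjoint_family_on_def)
    finally show "c *\<^sub>C E ((\<lambda>t. h (g t)) -` {c}) x = (\<Sum>v\<in>{v\<in>range g. h v = c}. h v *\<^sub>C E (g -` {v}) x)"
      by (simp add: scaleC_sum_right)
  qed
  also have "\<dots> = (\<Sum>v\<in>range g. h v *\<^sub>C E (g -` {v}) x)"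
    using fin by (rule sum.image_gen[symmetric])
  finally show ?thesis .
qed

lemma simple_spectral_integral_diff:
  assumes "simple_function borel s" "simple_function borel s'"
  shows "simple_spectral_integral E (\<lambda>t. s t - s' t) x
       = simple_spectral_integral E s x - simple_spectral_integral E s' x"
proof -
  have g: "simple_function borel (\<lambda>t. (s t, s' t))"
    using assms by (rule simple_function_Pair)
  show ?thesis
    using simple_spectral_integral_compose[OF g, of "\<lambda>(a, b). a - b" x]
      simple_spectral_integral_compose[OF g, of fst x] simple_spectral_integral_compose[OF g, of snd x]
    by (simp add: case_prod_unfold scaleC_diff_left sum_subtractf)
qed

lemma simple_spectral_integral_add_right:
  assumes "simple_function borel s"
  shows "simple_spectral_integral E s (x + y) = simple_spectral_integral E s x + simple_spectral_integral E s y"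
  using simple_functionD[OF assms]
  by (simp add: simple_spectral_integral_def E_add scaleC_add_right sum.distrib)

lemma simple_spectral_integral_scaleC_right:
  assumes "simple_function borel s"
  shows "simple_spectral_integral E s (a *\<^sub>C x) = a *\<^sub>C simple_spectral_integral E s x"
  using simple_functionD[OF assms]
  by (simp add: simple_spectral_integral_def E_scaleC scaleC_scaleC mult.commute scaleC_sum_right)

lemma simple_spectral_integral_tendsto:
  assumes s: "simple_function borel s" and f: "f \<longlonglongrightarrow> l"
  shows "(\<lambda>n. simple_spectral_integral E s (f n)) \<longlonglongrightarrow> simple_spectral_integral E s l"
  unfolding simple_spectral_integral_def
proof (rule tendsto_sum)
  fix c
  have "s -` {c} \<in> sets borel"
    using simple_functionD[OF s] by auto
  then show "(\<lambda>n. c *\<^sub>C E (s -` {c}) (f n)) \<longlonglongrightarrow> c *\<^sub>C E (s -` {c}) l"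
    by (intro bounded_linear.tendsto[OF bounded_linear_scaleC] bounded_linear.tendsto[OF bounded_linear_E] f)
qed

text \<open>
  The isometry property on simple functions, by the theorem of Pythagoras.
\<close>

lemma norm_simple_spectral_integral:
  assumes s: "simple_function borel s"
  shows "(\<integral>\<^sup>+t. ennreal ((cmod (s t))\<^sup>2) \<partial>scalar_measure E x) = ennreal ((norm (simple_spectral_integral E s x))\<^sup>2)"
proof -
  have fin: "finite (range s)" and B: "s -` {c} \<in> sets borel" for c
    using simple_functionD[OF s] by auto
  have s': "simple_function (scalar_measure E x) s"
    using s by (simp add: simple_function_def)
  have orth: "inner (c *\<^sub>C E (s -` {c}) x) (d *\<^sub>C E (s -` {d}) x) = 0" if "c \<noteq> d" for c d
  proof -
    have "cinner (E (s -` {c}) x) (E (s -` {d}) x) = cinner x (E (s -` {c}) (E (s -` {d}) x))"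
      by (rule E_symmetric[OF B])
    also have "E (s -` {c}) (E (s -` {d}) x) = 0"
      using that by (intro E_disjoint B) auto
    finally show ?thesis
      by (simp add: cinner_scaleC_left cinner_scaleC_right flip: Re_cinner)
  qed
  have "(norm (simple_spectral_integral E s x))\<^sup>2
      = (\<Sum>c\<in>range s. (norm (c *\<^sub>C E (s -` {c}) x))\<^sup>2)"
    unfolding simple_spectral_integral_def
    using fin orth by (intro norm_sum_Pythagorean) (auto simp: pairwise_def orthogonal_def)
  also have "ennreal \<dots> = (\<Sum>c\<in>range s. ennreal ((cmod c)\<^sup>2) * ennreal ((norm (E (s -` {c}) x))\<^sup>2))"
    by (simp add: norm_scaleC power_mult_distrib ennreal_mult flip: sum_ennreal)
  also have "\<dots> = (\<Sum>c\<in>s ` space (scalar_measure E x). ennreal ((cmod c)\<^sup>2) *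
      emeasure (scalar_measure E x) {t \<in> space (scalar_measure E x). s t = c})"
    using B by (simp add: emeasure_scalar_measure vimage_def)
  also have "\<dots> = integral\<^sup>S (scalar_measure E x) (\<lambda>t. ennreal ((cmod (s t))\<^sup>2))"
    by (intro simple_function_partition[symmetric] simple_function_compose1[OF s']) (auto simp: s')
  also have "\<dots> = (\<integral>\<^sup>+t. ennreal ((cmod (s t))\<^sup>2) \<partial>scalar_measure E x)"
    by (intro nn_integral_eq_simple_integral[symmetric] simple_function_compose1[OF s'])
  finally show ?thesis ..
qed

text \<open>
  The squared norm of \<open>f\<close> in \<open>L\<^sup>2\<close> of the scalar measure of \<open>x\<close>, possibly infinite; the domain of \<open>\<integral> f dE\<close> is where
  it is finite.
\<close>

abbreviation sq_integral :: "(real \<Rightarrow> complex) \<Rightarrow> 'a \<Rightarrow> ennreal" where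
  "sq_integral f x \<equiv> \<integral>\<^sup>+t. ennreal ((cmod (f t))\<^sup>2) \<partial>scalar_measure E x"

text \<open>
  The functional \<open>x \<mapsto> \<integral> \<bar>f\<bar>\<^sup>2 d\<mu>\<^sub>x\<close> is a supremum of squared norms of bounded operators. From this it
  follows that it is subadditive up to a factor 2, so that the domain is a subspace, and that it is lower
  semicontinuous, so that the operator is closed.
\<close>

lemma sq_integral_sup:
  assumes f: "f \<in> borel_measurable borel"
  obtains u :: "nat \<Rightarrow> real \<Rightarrow> complex" where "\<And>n. simple_function borel (u n)"
    "\<And>x. sq_integral f x = (SUP n. ennreal ((norm (simple_spectral_integral E (u n) x))\<^sup>2))"
proof -
  have "(\<lambda>t. ennreal ((cmod (f t))\<^sup>2)) \<in> borel_measurable borel"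
    using f by measurable
  then obtain F where F: "\<And>i. simple_function borel (F i)" "incseq F" "\<And>i x. F i x < top"
    "\<And>x. (SUP i. F i x) = ennreal ((cmod (f x))\<^sup>2)"
    using borel_measurable_implies_simple_function_sequence' by blast
  define u where "u i t = complex_of_real (sqrt (enn2real (F i t)))" for i t
  have u: "simple_function borel (u i)" for i
    unfolding u_def by (intro simple_function_compose1[OF F(1)])
  have uF: "ennreal ((cmod (u i t))\<^sup>2) = F i t" for i t
    using F(3)[of i t] by (simp add: u_def)
  have sup: "sq_integral f x = (SUP n. ennreal ((norm (simple_spectral_integral E (u n) x))\<^sup>2))" for x
  proof -
    have "sq_integral f x = (\<integral>\<^sup>+t. (SUP n. F n t) \<partial>scalar_measure E x)"
      by (simp add: F(4))
    also have "\<dots> = (SUP n. \<integral>\<^sup>+t. F n t \<partial>scalar_measure E x)"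
    proof (rule nn_integral_monotone_convergence_SUP[OF F(2)])
      fix n show "F n \<in> borel_measurable (scalar_measure E x)"
        using borel_measurable_simple_function[OF F(1)] by simp
    qed
    also have "\<dots> = (SUP n. ennreal ((norm (simple_spectral_integral E (u n) x))\<^sup>2))"
      by (simp flip: uF norm_simple_spectral_integral[OF u])
    finally show ?thesis .
  qed
  show ?thesis
    by (rule that[OF u sup])
qed

lemma sq_integral_add_le:
  assumes "f \<in> borel_measurable borel"
  shows "sq_integral f (x + y) \<le> 2 * sq_integral f x + 2 * sq_integral f y"
proof -
  obtain u :: "nat \<Rightarrow> real \<Rightarrow> complex" where u: "\<And>n. simple_function borel (u n)"
    "\<And>x. sq_integral f x = (SUP n. ennreal ((norm (simple_spectral_integral E (u n) x))\<^sup>2))"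
    by (rule sq_integral_sup[OF assms]) blast
  have le: "ennreal ((norm (simple_spectral_integral E (u n) x))\<^sup>2) \<le> sq_integral f x" for n x
    unfolding u(2) by (rule SUP_upper) simp
  show ?thesis
    unfolding u(2)[of "x + y"]
  proof (rule SUP_least)
    fix n
    have "ennreal ((norm (simple_spectral_integral E (u n) (x + y)))\<^sup>2)
        \<le> 2 * ennreal ((norm (simple_spectral_integral E (u n) x))\<^sup>2)
          + 2 * ennreal ((norm (simple_spectral_integral E (u n) y))\<^sup>2)"
      unfolding simple_spectral_integral_add_right[OF u(1)] by (rule ennreal_norm_add_le)
    also have "\<dots> \<le> 2 * sq_integral f x + 2 * sq_integral f y"
      by (intro add_mono mult_left_mono le) auto
    finally show "ennreal ((norm (simple_spectral_integral E (u n) (x + y)))\<^sup>2) \<le> \<dots>" .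
  qed
qed

lemma sq_integral_scaleC_le:
  assumes "f \<in> borel_measurable borel"
  shows "sq_integral f (a *\<^sub>C x) \<le> ennreal ((cmod a)\<^sup>2) * sq_integral f x"
proof -
  obtain u :: "nat \<Rightarrow> real \<Rightarrow> complex" where u: "\<And>n. simple_function borel (u n)"
    "\<And>x. sq_integral f x = (SUP n. ennreal ((norm (simple_spectral_integral E (u n) x))\<^sup>2))"
    by (rule sq_integral_sup[OF assms]) blast
  show ?thesis
    unfolding u(2)[of "a *\<^sub>C x"]
  proof (rule SUP_least)
    fix n
    have "ennreal ((norm (simple_spectral_integral E (u n) (a *\<^sub>C x)))\<^sup>2)
        = ennreal ((cmod a)\<^sup>2) * ennreal ((norm (simple_spectral_integral E (u n) x))\<^sup>2)"
      by (simp add: simple_spectral_integral_scaleC_right[OF u(1)] norm_scaleC power_mult_distrib ennreal_mult)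
    also have "\<dots> \<le> ennreal ((cmod a)\<^sup>2) * sq_integral f x"
      unfolding u(2)[of x] by (intro mult_left_mono SUP_upper) auto
    finally show "ennreal ((norm (simple_spectral_integral E (u n) (a *\<^sub>C x)))\<^sup>2) \<le> \<dots>" .
  qed
qed

lemma csubspace_op_dom:
  assumes f: "f \<in> borel_measurable borel"
  shows "csubspace (op_dom (spectral_integral E f))"
  unfolding csubspace_def spectral_integral_def unbounded_op.sel mem_Collect_eq
proof (intro conjI ballI allI)
  show "sq_integral f 0 < \<infinity>"
    using sq_integral_scaleC_le[OF f, of 0 0] by simp
  show "sq_integral f (x + y) < \<infinity>"
    if "x \<in> {x. sq_integral f x < \<infinity>}" "y \<in> {x. sq_integral f x < \<infinity>}" for x y
    using that by (intro le_less_trans[OF sq_integral_add_le[OF f]]) (auto simp: ennreal_mult_less_top)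
  show "sq_integral f (a *\<^sub>C x) < \<infinity>" if "x \<in> {x. sq_integral f x < \<infinity>}" for a x
    using that by (intro le_less_trans[OF sq_integral_scaleC_le[OF f]]) (auto simp: ennreal_mult_less_top)
qed

text \<open>
  One sequence of simple functions approximates \<open>f\<close> in \<open>L\<^sup>2\<close> of the scalar measure of every vector in the
  domain.
\<close>

lemma approximating_simple_functions:
  assumes f: "f \<in> borel_measurable borel"
  obtains s where "\<And>n. simple_function borel (s n)"
    "\<And>x. sq_integral f x < \<infinity> \<Longrightarrow> (\<lambda>n. sq_integral (\<lambda>t. f t - s n t) x) \<longlonglongrightarrow> 0"
    "\<And>x. sq_integral f x < \<infinity> \<Longrightarrow> (\<lambda>n. sq_integral (s n) x) \<longlonglongrightarrow> sq_integral f x"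
proof -
  note [measurable] = f
  obtain s where s: "\<And>n. simple_function borel (s n)" "\<And>t. (\<lambda>n. s n t) \<longlonglongrightarrow> f t"
    "\<And>n t. cmod (s n t) \<le> 2 * cmod (f t)"
    using borel_measurable_implies_sequence_metric[OF f, of 0] by auto
  have [measurable]: "s n \<in> borel_measurable borel" for n
    using s(1) by (rule borel_measurable_simple_function)
  show ?thesis
  proof (rule that[OF s(1)])
    fix x assume fin: "sq_integral f x < \<infinity>"
    have fin': "(\<integral>\<^sup>+t. ennreal (c * (cmod (f t))\<^sup>2) \<partial>scalar_measure E x) < \<infinity>" if "0 \<le> c" for c
      using fin that by (simp add: ennreal_mult nn_integral_cmult ennreal_mult_less_top)
    have "(\<lambda>n. sq_integral (\<lambda>t. f t - s n t) x) \<longlonglongrightarrow> (\<integral>\<^sup>+t. 0 \<partial>scalar_measure E x)"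
    proof (rule nn_integral_dominated_convergence[where w = "\<lambda>t. ennreal (9 * (cmod (f t))\<^sup>2)"])
      show "AE t in scalar_measure E x. ennreal ((cmod (f t - s n t))\<^sup>2) \<le> ennreal (9 * (cmod (f t))\<^sup>2)" for n
      proof (intro AE_I2 ennreal_leI)
        fix t
        have "cmod (f t - s n t) \<le> 3 * cmod (f t)"
          using norm_triangle_ineq4[of "f t" "s n t"] s(3)[of n t] by linarith
        then have "(cmod (f t - s n t))\<^sup>2 \<le> (3 * cmod (f t))\<^sup>2"
          by (intro power_mono) auto
        then show "(cmod (f t - s n t))\<^sup>2 \<le> 9 * (cmod (f t))\<^sup>2"
          by (simp add: power_mult_distrib)
      qed
      show "AE t in scalar_measure E x. (\<lambda>n. ennreal ((cmod (f t - s n t))\<^sup>2)) \<longlonglongrightarrow> 0"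
      proof (intro AE_I2)
        fix t
        have "(\<lambda>n. ennreal ((cmod (f t - s n t))\<^sup>2)) \<longlonglongrightarrow> ennreal ((cmod (f t - f t))\<^sup>2)"
          by (intro tendsto_intros s(2))
        then show "(\<lambda>n. ennreal ((cmod (f t - s n t))\<^sup>2)) \<longlonglongrightarrow> 0"
          by simp
      qed
    qed (use fin' in auto)
    then show "(\<lambda>n. sq_integral (\<lambda>t. f t - s n t) x) \<longlonglongrightarrow> 0"
      by simp
    show "(\<lambda>n. sq_integral (s n) x) \<longlonglongrightarrow> sq_integral f x"
    proof (rule nn_integral_dominated_convergence[where w = "\<lambda>t. ennreal (4 * (cmod (f t))\<^sup>2)"])
      show "AE t in scalar_measure E x. ennreal ((cmod (s n t))\<^sup>2) \<le> ennreal (4 * (cmod (f t))\<^sup>2)" for n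
      proof (intro AE_I2 ennreal_leI)
        fix t
        have "(cmod (s n t))\<^sup>2 \<le> (2 * cmod (f t))\<^sup>2"
          using s(3) by (intro power_mono) auto
        then show "(cmod (s n t))\<^sup>2 \<le> 4 * (cmod (f t))\<^sup>2"
          by (simp add: power_mult_distrib)
      qed
      show "AE t in scalar_measure E x. (\<lambda>n. ennreal ((cmod (s n t))\<^sup>2)) \<longlonglongrightarrow> ennreal ((cmod (f t))\<^sup>2)"
        by (intro AE_I2 tendsto_intros s(2))
    qed (use fin' in auto)
  qed
qed

lemma sq_integral_triangle:
  assumes [measurable]: "f \<in> borel_measurable borel" "g \<in> borel_measurable borel" "h \<in> borel_measurable borel"
  shows "sq_integral (\<lambda>t. g t - h t) x
    \<le> 2 * sq_integral (\<lambda>t. f t - g t) x + 2 * sq_integral (\<lambda>t. f t - h t) x"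
proof -
  have "sq_integral (\<lambda>t. g t - h t) x
      \<le> (\<integral>\<^sup>+t. 2 * ennreal ((cmod (f t - g t))\<^sup>2) + 2 * ennreal ((cmod (f t - h t))\<^sup>2) \<partial>scalar_measure E x)"
  proof (rule nn_integral_mono)
    fix t
    have "ennreal ((cmod (g t - h t))\<^sup>2) = ennreal ((cmod (- (f t - g t) + (f t - h t)))\<^sup>2)"
      by simp
    also have "\<dots> \<le> 2 * ennreal ((cmod (- (f t - g t)))\<^sup>2) + 2 * ennreal ((cmod (f t - h t))\<^sup>2)"
      by (rule ennreal_norm_add_le)
    finally show "ennreal ((cmod (g t - h t))\<^sup>2)
        \<le> 2 * ennreal ((cmod (f t - g t))\<^sup>2) + 2 * ennreal ((cmod (f t - h t))\<^sup>2)"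
      unfolding norm_minus_cancel .
  qed
  also have "\<dots> = 2 * sq_integral (\<lambda>t. f t - g t) x + 2 * sq_integral (\<lambda>t. f t - h t) x"
    by (simp add: nn_integral_add nn_integral_cmult)
  finally show ?thesis .
qed

lemma norm_simple_diff_le:
  assumes f: "f \<in> borel_measurable borel" and s: "simple_function borel s" and s': "simple_function borel s'"
  shows "ennreal ((norm (simple_spectral_integral E s x - simple_spectral_integral E s' x))\<^sup>2)
    \<le> 2 * sq_integral (\<lambda>t. f t - s t) x + 2 * sq_integral (\<lambda>t. f t - s' t) x"
proof -
  have "simple_function borel (\<lambda>t. s t - s' t)"
    using s s' by (rule simple_function_diff)
  then show ?thesis
    using sq_integral_triangle[OF f borel_measurable_simple_function[OF s] borel_measurable_simple_function[OF s']]
    by (simp add: norm_simple_spectral_integral simple_spectral_integral_diff[OF s s'])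
qed

lemma has_spectral_integral_unique:
  assumes f: "f \<in> borel_measurable borel"
    and "has_spectral_integral E f x y" "has_spectral_integral E f x z"
  shows "y = z"
proof -
  obtain s s' where s: "\<And>n::nat. simple_function borel (s n)" "(\<lambda>n. sq_integral (\<lambda>t. f t - s n t) x) \<longlonglongrightarrow> 0"
      "(\<lambda>n. simple_spectral_integral E (s n) x) \<longlonglongrightarrow> y"
    and s': "\<And>n::nat. simple_function borel (s' n)" "(\<lambda>n. sq_integral (\<lambda>t. f t - s' n t) x) \<longlonglongrightarrow> 0"
      "(\<lambda>n. simple_spectral_integral E (s' n) x) \<longlonglongrightarrow> z"
    using assms unfolding has_spectral_integral_def by blast
  have "(\<lambda>n. (norm (simple_spectral_integral E (s n) x - simple_spectral_integral E (s' n) x))\<^sup>2) \<longlonglongrightarrow> 0"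
    by (rule ennreal_double_bound_tendsto[OF norm_simple_diff_le[OF f s(1) s'(1)] s(2) s'(2)]) simp
  then have "(\<lambda>n. simple_spectral_integral E (s n) x - simple_spectral_integral E (s' n) x) \<longlonglongrightarrow> 0"
    by (simp add: tendsto_norm_zero_iff)
  moreover have "(\<lambda>n. simple_spectral_integral E (s n) x - simple_spectral_integral E (s' n) x) \<longlonglongrightarrow> y - z"
    by (intro tendsto_diff s s')
  ultimately show ?thesis
    using LIMSEQ_unique by fastforce
qed

lemma simple_integrals_converge:
  assumes f: "f \<in> borel_measurable borel" and s: "\<And>n. simple_function borel (s n)"
    and lim: "(\<lambda>n. sq_integral (\<lambda>t. f t - s n t) x) \<longlonglongrightarrow> 0"
  obtains y where "(\<lambda>n. simple_spectral_integral E (s n) x) \<longlonglongrightarrow> y"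
proof -
  have "Cauchy (\<lambda>n. simple_spectral_integral E (s n) x)"
  proof (rule metric_CauchyI)
    fix e :: real assume e: "0 < e"
    have "eventually (\<lambda>n. sq_integral (\<lambda>t. f t - s n t) x < ennreal (e\<^sup>2 / 4)) sequentially"
      using lim e by (intro order_tendstoD) auto
    then obtain N where N: "\<And>n. n \<ge> N \<Longrightarrow> sq_integral (\<lambda>t. f t - s n t) x < ennreal (e\<^sup>2 / 4)"
      unfolding eventually_sequentially by blast
    show "\<exists>M. \<forall>m\<ge>M. \<forall>n\<ge>M. dist (simple_spectral_integral E (s m) x) (simple_spectral_integral E (s n) x) < e"
    proof (intro exI[of _ N] allI impI)
      fix m n assume "N \<le> m" "N \<le> n"
      have "ennreal ((dist (simple_spectral_integral E (s m) x) (simple_spectral_integral E (s n) x))\<^sup>2)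
          \<le> 2 * sq_integral (\<lambda>t. f t - s m t) x + 2 * sq_integral (\<lambda>t. f t - s n t) x"
        unfolding dist_norm by (rule norm_simple_diff_le[OF f s s])
      also have "\<dots> < 2 * ennreal (e\<^sup>2 / 4) + 2 * ennreal (e\<^sup>2 / 4)"
        by (intro add_strict_mono ennreal_mult_strict_left_mono N \<open>N \<le> m\<close> \<open>N \<le> n\<close>) auto
      also have "\<dots> = ennreal (2 * (e\<^sup>2 / 4)) + ennreal (2 * (e\<^sup>2 / 4))"
        by (simp only: ennreal_mult' zero_le_numeral ennreal_numeral)
      also have "\<dots> = ennreal (e\<^sup>2)"
        by (subst ennreal_plus[symmetric]) auto
      finally have "(dist (simple_spectral_integral E (s m) x) (simple_spectral_integral E (s n) x))\<^sup>2 < e\<^sup>2"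
        by (subst (asm) ennreal_less_iff) auto
      then show "dist (simple_spectral_integral E (s m) x) (simple_spectral_integral E (s n) x) < e"
        using e by (rule power2_less_imp_less[OF _ less_imp_le])
    qed
  qed
  then show ?thesis
    using that Cauchy_convergent convergent_def by blast
qed

lemma op_app_eqI:
  assumes "f \<in> borel_measurable borel" "has_spectral_integral E f x y"
  shows "op_app (spectral_integral E f) x = y"
  using assms has_spectral_integral_unique unfolding spectral_integral_def by auto

lemma mem_op_dom: "x \<in> op_dom (spectral_integral E f) \<longleftrightarrow> sq_integral f x < \<infinity>"
  by (simp add: spectral_integral_def)

lemma op_app_tendsto:
  assumes f: "f \<in> borel_measurable borel" and s: "\<And>n. simple_function borel (s n)"
    and lim: "(\<lambda>n. sq_integral (\<lambda>t. f t - s n t) x) \<longlonglongrightarrow> 0"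
  shows "(\<lambda>n. simple_spectral_integral E (s n) x) \<longlonglongrightarrow> op_app (spectral_integral E f) x"
proof -
  obtain y where y: "(\<lambda>n. simple_spectral_integral E (s n) x) \<longlonglongrightarrow> y"
    by (rule simple_integrals_converge[OF f s lim]) blast
  have "has_spectral_integral E f x y"
    unfolding has_spectral_integral_def by (intro exI[of _ s] conjI allI s lim y)
  from op_app_eqI[OF f this] y show ?thesis
    by simp
qed

lemma linear_op_spectral_integral:
  assumes f: "f \<in> borel_measurable borel"
  shows "linear_op (spectral_integral E f)"
proof -
  let ?T = "spectral_integral E f"
  obtain s where s: "\<And>n. simple_function borel (s n)"
    "\<And>x. sq_integral f x < \<infinity> \<Longrightarrow> (\<lambda>n. sq_integral (\<lambda>t. f t - s n t) x) \<longlonglongrightarrow> 0"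
    by (rule approximating_simple_functions[OF f]) blast
  have lim: "(\<lambda>n. simple_spectral_integral E (s n) x) \<longlonglongrightarrow> op_app ?T x" if "x \<in> op_dom ?T" for x
    using that by (intro op_app_tendsto f s) (simp add: mem_op_dom)
  note dom = csubspace_op_dom[OF f]
  have "op_app ?T (x + y) = op_app ?T x + op_app ?T y" if "x \<in> op_dom ?T" "y \<in> op_dom ?T" for x y
  proof (rule LIMSEQ_unique)
    show "(\<lambda>n. simple_spectral_integral E (s n) (x + y)) \<longlonglongrightarrow> op_app ?T (x + y)"
      using that dom by (intro lim) (auto simp: csubspace_def)
    show "(\<lambda>n. simple_spectral_integral E (s n) (x + y)) \<longlonglongrightarrow> op_app ?T x + op_app ?T y"
      unfolding simple_spectral_integral_add_right[OF s(1)] by (intro tendsto_add lim that)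
  qed
  moreover have "op_app ?T (a *\<^sub>C x) = a *\<^sub>C op_app ?T x" if "x \<in> op_dom ?T" for a x
  proof (rule LIMSEQ_unique)
    show "(\<lambda>n. simple_spectral_integral E (s n) (a *\<^sub>C x)) \<longlonglongrightarrow> op_app ?T (a *\<^sub>C x)"
      using that dom by (intro lim) (auto simp: csubspace_def)
    show "(\<lambda>n. simple_spectral_integral E (s n) (a *\<^sub>C x)) \<longlonglongrightarrow> a *\<^sub>C op_app ?T x"
      unfolding simple_spectral_integral_scaleC_right[OF s(1)]
      by (intro bounded_linear.tendsto[OF bounded_linear_scaleC] lim that)
  qed
  ultimately show ?thesis
    using dom by (simp add: linear_op_def)
qed

lemma norm_op_app:
  assumes f: "f \<in> borel_measurable borel" and x: "x \<in> op_dom (spectral_integral E f)"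
  shows "ennreal ((norm (op_app (spectral_integral E f) x))\<^sup>2) = sq_integral f x"
proof -
  obtain s where s: "\<And>n. simple_function borel (s n)"
    "\<And>x. sq_integral f x < \<infinity> \<Longrightarrow> (\<lambda>n. sq_integral (\<lambda>t. f t - s n t) x) \<longlonglongrightarrow> 0"
    "\<And>x. sq_integral f x < \<infinity> \<Longrightarrow> (\<lambda>n. sq_integral (s n) x) \<longlonglongrightarrow> sq_integral f x"
    by (rule approximating_simple_functions[OF f]) blast
  have "(\<lambda>n. simple_spectral_integral E (s n) x) \<longlonglongrightarrow> op_app (spectral_integral E f) x"
    using x by (intro op_app_tendsto f s) (simp add: mem_op_dom)
  then have "(\<lambda>n. ennreal ((norm (simple_spectral_integral E (s n) x))\<^sup>2))
      \<longlonglongrightarrow> ennreal ((norm (op_app (spectral_integral E f) x))\<^sup>2)"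
    by (intro tendsto_intros)
  moreover have "(\<lambda>n. ennreal ((norm (simple_spectral_integral E (s n) x))\<^sup>2)) \<longlonglongrightarrow> sq_integral f x"
    using s(3)[of x] x by (simp add: mem_op_dom norm_simple_spectral_integral[OF s(1)])
  ultimately show ?thesis
    by (rule LIMSEQ_unique)
qed

lemma op_dom_diff:
  assumes f: "f \<in> borel_measurable borel"
    and "x \<in> op_dom (spectral_integral E f)" "y \<in> op_dom (spectral_integral E f)"
  shows "x - y \<in> op_dom (spectral_integral E f)"
proof -
  have "x + (- 1) *\<^sub>C y \<in> op_dom (spectral_integral E f)"
    using csubspace_op_dom[OF f] assms(2,3) unfolding csubspace_def by blast
  then show ?thesis
    by (simp add: scaleC_minus_left)
qed

text \<open>
  Closedness of \<open>\<integral> f dE\<close>, by lower semicontinuity of \<open>x \<mapsto> \<integral> \<bar>f\<bar>\<^sup>2 d\<mu>\<^sub>x\<close>.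
\<close>

theorem spectral_integral_closed:
  assumes f: "f \<in> borel_measurable borel"
    and x: "\<And>n. x n \<in> op_dom (spectral_integral E f)" and l: "x \<longlonglongrightarrow> l"
    and cauchy: "\<And>e. 0 < e \<Longrightarrow> \<exists>N. \<forall>n\<ge>N. \<forall>m\<ge>N. norm (op_app (spectral_integral E f) (x n - x m)) \<le> e"
  shows "l \<in> op_dom (spectral_integral E f)"
    and "(\<lambda>n. op_app (spectral_integral E f) (x n - l)) \<longlonglongrightarrow> 0"
proof -
  let ?T = "spectral_integral E f"
  obtain u :: "nat \<Rightarrow> real \<Rightarrow> complex" where u: "\<And>n. simple_function borel (u n)"
    "\<And>x. sq_integral f x = (SUP n. ennreal ((norm (simple_spectral_integral E (u n) x))\<^sup>2))"
    by (rule sq_integral_sup[OF f]) blast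
  have bound: "\<exists>N. \<forall>n\<ge>N. sq_integral f (x n - l) \<le> ennreal (e\<^sup>2)" if e: "0 < e" for e
  proof -
    obtain N where N: "\<And>n m. n \<ge> N \<Longrightarrow> m \<ge> N \<Longrightarrow> norm (op_app ?T (x n - x m)) \<le> e"
      using cauchy[OF e] by blast
    have "sq_integral f (x n - l) \<le> ennreal (e\<^sup>2)" if n: "N \<le> n" for n
      unfolding u(2)
    proof (rule SUP_least)
      fix k
      have lim: "(\<lambda>m. ennreal ((norm (simple_spectral_integral E (u k) (x n - x m)))\<^sup>2))
          \<longlonglongrightarrow> ennreal ((norm (simple_spectral_integral E (u k) (x n - l)))\<^sup>2)"
        by (intro tendsto_intros simple_spectral_integral_tendsto u l)
      have le: "ennreal ((norm (simple_spectral_integral E (u k) (x n - x m)))\<^sup>2) \<le> ennreal (e\<^sup>2)"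
        if m: "N \<le> m" for m
      proof -
        have "ennreal ((norm (simple_spectral_integral E (u k) (x n - x m)))\<^sup>2) \<le> sq_integral f (x n - x m)"
          unfolding u(2) by (rule SUP_upper) simp
        also have "\<dots> = ennreal ((norm (op_app ?T (x n - x m)))\<^sup>2)"
          by (intro norm_op_app[symmetric] f op_dom_diff x)
        also have "\<dots> \<le> ennreal (e\<^sup>2)"
          using N[OF n m] by (intro ennreal_leI power_mono) auto
        finally show ?thesis .
      qed
      show "ennreal ((norm (simple_spectral_integral E (u k) (x n - l)))\<^sup>2) \<le> ennreal (e\<^sup>2)"
        by (rule LIMSEQ_le_const2[OF lim]) (use le in blast)
    qed
    then show ?thesis
      by blast
  qed
  obtain N where N: "\<And>n. n \<ge> N \<Longrightarrow> sq_integral f (x n - l) \<le> ennreal (1\<^sup>2)"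
    using bound[OF zero_less_one] by blast
  have "sq_integral f (x N - l) < \<infinity>"
    by (rule le_less_trans[OF N[OF order_refl]]) simp
  then have "x N - l \<in> op_dom ?T"
    by (simp add: mem_op_dom)
  then have "x N - (x N - l) \<in> op_dom ?T"
    by (rule op_dom_diff[OF f x])
  then show ldom: "l \<in> op_dom ?T"
    by simp
  show "(\<lambda>n. op_app ?T (x n - l)) \<longlonglongrightarrow> 0"
  proof (rule LIMSEQ_I)
    fix e :: real assume "0 < e"
    then obtain N where N: "\<And>n. n \<ge> N \<Longrightarrow> sq_integral f (x n - l) \<le> ennreal ((e / 2)\<^sup>2)"
      using bound[OF half_gt_zero] by blast
    have "norm (op_app ?T (x n - l) - 0) < e" if "N \<le> n" for n
    proof -
      have "ennreal ((norm (op_app ?T (x n - l)))\<^sup>2) \<le> ennreal ((e / 2)\<^sup>2)"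
        using N[OF that] by (subst norm_op_app[OF f op_dom_diff[OF f x ldom]])
      then have "norm (op_app ?T (x n - l)) \<le> e / 2"
        using \<open>0 < e\<close> by (subst (asm) ennreal_le_iff) (auto intro: power2_le_imp_le)
      then show ?thesis
        using \<open>0 < e\<close> by simp
    qed
    then show "\<exists>N. \<forall>n\<ge>N. norm (op_app ?T (x n - l) - 0) < e"
      by blast
  qed
qed

end


section \<open>The resolvent of a semi-bounded self-adjoint operator\<close>

theorem orthogonal_projection_exists:
  fixes M :: "'a::{real_inner, complete_space} set" and z :: 'a
  assumes M: "subspace M" and closed: "closed M"
  obtains m where "m \<in> M" "\<And>w. w \<in> M \<Longrightarrow> inner w (z - m) = 0"
proof -
  \<comment> \<open>A minimising sequence for the squared distance is Cauchy by the parallelogram law.\<close>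
  define D where "D = (INF m\<in>M. (norm (z - m))\<^sup>2)"
  have bdd: "bdd_below ((\<lambda>m. (norm (z - m))\<^sup>2) ` M)"
    by (auto intro!: bdd_belowI[of _ 0])
  have ne: "M \<noteq> {}"
    using subspace_0[OF M] by auto
  have D_le: "D \<le> (norm (z - m))\<^sup>2" if "m \<in> M" for m
    unfolding D_def using bdd that by (rule cINF_lower)
  have "\<exists>m\<in>M. (norm (z - m))\<^sup>2 < D + inverse (real (Suc n))" for n
  proof -
    have "D < D + inverse (real (Suc n))"
      by simp
    then show ?thesis
      unfolding D_def using cINF_less_iff[OF ne bdd] by blast
  qed
  then obtain m where m: "\<And>n. m n \<in> M" "\<And>n. (norm (z - m n))\<^sup>2 < D + inverse (real (Suc n))"
    by metis
  have dist: "(norm (m i - m j))\<^sup>2 \<le> 2 * inverse (real (Suc i)) + 2 * inverse (real (Suc j))" for i j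
  proof -
    have "(1/2) *\<^sub>R (m i + m j) \<in> M"
      using M m by (intro subspace_scale subspace_add) auto
    then have "D \<le> (norm (z - (1/2) *\<^sub>R (m i + m j)))\<^sup>2"
      by (rule D_le)
    moreover have "(norm (m i - m j))\<^sup>2
        = 2 * (norm (z - m i))\<^sup>2 + 2 * (norm (z - m j))\<^sup>2 - 4 * (norm (z - (1/2) *\<^sub>R (m i + m j)))\<^sup>2"
      by (simp add: power2_norm_eq_inner inner_diff_left inner_diff_right inner_add_left inner_add_right
          inner_commute algebra_simps)
    ultimately show ?thesis
      using m(2)[of i] m(2)[of j] by linarith
  qed
  have "Cauchy m"
  proof (rule metric_CauchyI)
    fix e :: real assume e: "0 < e"
    then obtain N where N: "inverse (real (Suc N)) < e\<^sup>2 / 4"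
      using reals_Archimedean[of "e\<^sup>2 / 4"] by auto
    show "\<exists>M. \<forall>i\<ge>M. \<forall>j\<ge>M. dist (m i) (m j) < e"
    proof (intro exI[of _ N] allI impI)
      fix i j assume "N \<le> i" "N \<le> j"
      then have "inverse (real (Suc i)) \<le> inverse (real (Suc N))" "inverse (real (Suc j)) \<le> inverse (real (Suc N))"
        by auto
      then have "(dist (m i) (m j))\<^sup>2 < e\<^sup>2"
        using dist[of i j] N unfolding dist_norm by linarith
      then show "dist (m i) (m j) < e"
        using e by (rule power2_less_imp_less[OF _ less_imp_le])
    qed
  qed
  then obtain l where l: "m \<longlonglongrightarrow> l"
    using Cauchy_convergent convergent_def by blast
  have lM: "l \<in> M"
    using closed_sequentially[OF closed m(1) l] .
  have "(\<lambda>n. (norm (z - m n))\<^sup>2) \<longlonglongrightarrow> (norm (z - l))\<^sup>2"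
    by (intro tendsto_intros l)
  moreover have "(\<lambda>n. D + inverse (real (Suc n))) \<longlonglongrightarrow> D + 0"
    by (intro tendsto_add tendsto_const LIMSEQ_inverse_real_of_nat)
  ultimately have "(norm (z - l))\<^sup>2 \<le> D + 0"
    by (rule LIMSEQ_le) (use m(2) in \<open>auto intro: less_imp_le\<close>)
  then have l_min: "(norm (z - l))\<^sup>2 \<le> (norm (z - w))\<^sup>2" if "w \<in> M" for w
    using D_le[OF that] by linarith
  show ?thesis
  proof (rule that[OF lM])
    fix w assume w: "w \<in> M"
    define b where "b = inner w (z - l)"
    \<comment> \<open>Moving the minimiser along \<open>t *\<^sub>R w\<close> would decrease the distance unless \<open>b = 0\<close>; the summand 1 avoids a division by 0.\<close>
    define t where "t = b / (inner w w + 1)"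
    have pos: "0 < inner w w + 1"
      by (simp add: add_nonneg_pos)
    have "(norm (z - l))\<^sup>2 \<le> (norm (z - (l + t *\<^sub>R w)))\<^sup>2"
      using M lM w by (intro l_min subspace_add subspace_scale)
    also have "\<dots> = (norm (z - l))\<^sup>2 - 2 * t * b + t\<^sup>2 * inner w w"
    proof -
      have "(norm (v - t *\<^sub>R w))\<^sup>2 = (norm v)\<^sup>2 - 2 * t * inner w v + t\<^sup>2 * inner w w" for v
        unfolding power2_norm_eq_inner
        by (simp add: inner_diff_left inner_diff_right inner_commute power2_eq_square algebra_simps)
      from this[of "z - l"] show ?thesis
        by (simp add: b_def diff_diff_eq)
    qed
    finally have "2 * t * b \<le> t\<^sup>2 * inner w w"
      by simp
    also have "\<dots> \<le> t\<^sup>2 * (inner w w + 1)"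
      by (intro mult_left_mono) auto
    also have "\<dots> = t * b"
      using pos by (simp add: t_def power2_eq_square)
    finally have "t * b \<le> 0"
      by (simp add: mult.commute)
    moreover have "t * b = b\<^sup>2 / (inner w w + 1)"
      by (simp add: t_def power2_eq_square)
    ultimately have "b\<^sup>2 \<le> 0"
      using pos by (simp add: divide_le_0_iff)
    then show "inner w (z - l) = 0"
      by (simp add: b_def)
  qed
qed

text \<open>
  Maximality of a self-adjoint operator: whatever lies in the domain of the adjoint lies in the domain.
\<close>

lemma self_adjoint_memI:
  fixes A :: "'a::complex_inner unbounded_op"
  assumes A: "self_adjoint A" and z: "\<And>x. x \<in> op_dom A \<Longrightarrow> cinner (op_app A x) y = cinner x z"
  shows "y \<in> op_dom A" and "op_app A y = z"
proof -
  have eq: "op_eq A (op_adjoint A)" and dense: "closure (op_dom A) = UNIV"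
    using A by (auto simp: self_adjoint_def densely_defined_def)
  have "y \<in> op_dom (op_adjoint A)"
    unfolding op_adjoint_def using z by auto
  with eq show y: "y \<in> op_dom A"
    by (simp add: op_eq_def)
  have unique: "z' = z" if z': "\<forall>x\<in>op_dom A. cinner (op_app A x) y = cinner x z'" for z'
  proof -
    have "inner x (z' - z) = 0" if "x \<in> op_dom A" for x
      using z[OF that] z' that by (simp add: cinner_diff_right flip: Re_cinner)
    then have "op_dom A \<subseteq> {x. inner x (z' - z) = 0}"
      by auto
    moreover have "closed {x. inner x (z' - z) = 0}"
      by (intro closed_Collect_eq continuous_intros)
    ultimately have "closure (op_dom A) \<subseteq> {x. inner x (z' - z) = 0}"
      by (rule closure_minimal)
    then have "inner (z' - z) (z' - z) = 0"
      using dense by blast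
    then show ?thesis
      by simp
  qed
  have "op_app A y = op_app (op_adjoint A) y"
    using eq y by (simp add: op_eq_def)
  also have "\<dots> = z"
    unfolding op_adjoint_def unbounded_op.sel using z unique by (intro the_equality) auto
  finally show "op_app A y = z" .
qed

lemma self_adjoint_symmetric:
  fixes A :: "'a::complex_inner unbounded_op"
  assumes A: "self_adjoint A" and x: "x \<in> op_dom A" and y: "y \<in> op_dom A"
  shows "cinner (op_app A x) y = cinner x (op_app A y)"
proof -
  have "y \<in> op_dom (op_adjoint A)"
    using A y by (simp add: self_adjoint_def op_eq_def)
  then obtain z where z: "\<And>x. x \<in> op_dom A \<Longrightarrow> cinner (op_app A x) y = cinner x z"
    unfolding op_adjoint_def by auto
  with self_adjoint_memI(2)[OF A z] x show ?thesis
    by simp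
qed

text \<open>
  The resolvent of a self-adjoint operator at a point one below a lower bound \<open>k\<close>. Since
  \<open>A - (k - 1) \<ge> 1\<close>, the operator \<open>R = (A - (k - 1))\<inverse>\<close> satisfies \<open>0 \<le> R \<le> 1\<close>.
\<close>

theorem resolvent_exists:
  fixes A :: "'a::chilbert_space unbounded_op"
  assumes A: "self_adjoint A" and k: "op_bounded_below_by A k"
  obtains R where "hilbert_contraction R" "inj R" "\<And>c x. R (c *\<^sub>C x) = c *\<^sub>C R x"
    "range R = op_dom A" "\<And>z. op_app A (R z) = z + (k - 1) *\<^sub>R R z"
proof -
  let ?D = "op_dom A"
  define a where "a = k - 1"
  define B where "B x = op_app A x - a *\<^sub>R x" for x
  have lin: "linear_op A"
    using A by (simp add: self_adjoint_def)
  have D0: "0 \<in> ?D" and D_add: "\<And>x y. x \<in> ?D \<Longrightarrow> y \<in> ?D \<Longrightarrow> x + y \<in> ?D"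
    and D_scaleC: "\<And>c x. x \<in> ?D \<Longrightarrow> c *\<^sub>C x \<in> ?D"
    using lin by (auto simp: linear_op_def csubspace_def)
  have B_add: "B (x + y) = B x + B y" if "x \<in> ?D" "y \<in> ?D" for x y
    using lin that by (simp add: linear_op_def B_def algebra_simps)
  have scaleC_R: "c *\<^sub>C (a *\<^sub>R x) = a *\<^sub>R (c *\<^sub>C x)" for c and x :: 'a
    by (simp add: scaleC_scaleC mult.commute flip: scaleC_of_real)
  have B_scaleC: "B (c *\<^sub>C x) = c *\<^sub>C B x" if "x \<in> ?D" for c x
    using lin that by (simp add: linear_op_def B_def scaleC_diff_right scaleC_R)
  have D_diff: "x - y \<in> ?D" and B_diff: "B (x - y) = B x - B y" if "x \<in> ?D" "y \<in> ?D" for x y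
    using D_add[of x "(-1) *\<^sub>C y"] D_scaleC[of y "-1"] B_add[of x "(-1) *\<^sub>C y"] B_scaleC[of y "-1"] that
    by (simp_all add: scaleC_minus_left)
  have B_sym: "cinner (B x) y = cinner x (B y)" if "x \<in> ?D" "y \<in> ?D" for x y
    using self_adjoint_symmetric[OF A that]
    by (simp add: B_def cinner_diff_left cinner_diff_right cinner_scaleR_left cinner_scaleR_right)
  have B_below: "(norm x)\<^sup>2 \<le> inner (B x) x" if "x \<in> ?D" for x
  proof -
    have "k * inner x x \<le> inner (op_app A x) x"
      using k that unfolding op_bounded_below_by_def Re_cinner by blast
    then show ?thesis
      by (simp add: B_def a_def inner_diff_left power2_norm_eq_inner algebra_simps)
  qed
  \<comment> \<open>Bounded below by 1, hence injective with closed range.\<close>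
  have B_norm: "norm x \<le> norm (B x)" if "x \<in> ?D" for x
  proof -
    have "norm x * norm x \<le> norm (B x) * norm x"
      using B_below[OF that] norm_cauchy_schwarz[of "B x" x] by (simp add: power2_eq_square)
    then show ?thesis
      by (cases "norm x = 0") (auto simp: mult_le_cancel_right)
  qed
  have B_inj: "x = y" if "x \<in> ?D" "y \<in> ?D" "B x = B y" for x y
    using B_norm[OF D_diff[OF that(1,2)]] B_diff[OF that(1,2)] that(3) by simp
  have sub: "subspace (B ` ?D)"
  proof (rule subspaceI)
    have "B 0 = 0"
      using B_diff[OF D0 D0] by simp
    then show "0 \<in> B ` ?D"
      using D0 by force
    show "x + y \<in> B ` ?D" if "x \<in> B ` ?D" "y \<in> B ` ?D" for x y
      using that B_add D_add by (metis (no_types, lifting) image_iff)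
    show "c *\<^sub>R x \<in> B ` ?D" if "x \<in> B ` ?D" for c x
      using that B_scaleC[of _ "complex_of_real c"] D_scaleC[of _ "complex_of_real c"]
      by (metis (no_types, lifting) image_iff scaleC_of_real)
  qed
  have cl: "closed (B ` ?D)"
    unfolding closed_sequential_limits
  proof (intro allI impI, elim conjE)
    fix y l assume y: "\<forall>n. y n \<in> B ` ?D" and lim: "y \<longlonglongrightarrow> l"
    then obtain x where x: "\<And>n. x n \<in> ?D" "\<And>n. y n = B (x n)"
      unfolding image_iff by metis
    have "Cauchy x"
    proof (rule metric_CauchyI)
      fix e :: real assume "0 < e"
      then obtain N where "\<forall>m\<ge>N. \<forall>n\<ge>N. dist (y m) (y n) < e"
        using metric_CauchyD[OF LIMSEQ_imp_Cauchy[OF lim]] by blast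
      moreover have "dist (x m) (x n) \<le> dist (y m) (y n)" for m n
        unfolding dist_norm x(2) B_diff[OF x(1) x(1), symmetric] by (intro B_norm D_diff x)
      ultimately show "\<exists>M. \<forall>m\<ge>M. \<forall>n\<ge>M. dist (x m) (x n) < e"
        by (meson le_less_trans)
    qed
    then obtain v where v: "x \<longlonglongrightarrow> v"
      using Cauchy_convergent convergent_def by blast
    have "op_app A (x n) = y n + a *\<^sub>R x n" for n
      by (simp add: x(2) B_def)
    then have Ax: "(\<lambda>n. op_app A (x n)) \<longlonglongrightarrow> l + a *\<^sub>R v"
      by (simp only:) (intro tendsto_intros lim v)
    have adj: "cinner (op_app A w) v = cinner w (l + a *\<^sub>R v)" if "w \<in> ?D" for w
    proof (rule LIMSEQ_unique)
      show "(\<lambda>n. cinner (op_app A w) (x n)) \<longlonglongrightarrow> cinner (op_app A w) v"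
        by (rule tendsto_cinner_right[OF v])
      show "(\<lambda>n. cinner (op_app A w) (x n)) \<longlonglongrightarrow> cinner w (l + a *\<^sub>R v)"
        unfolding self_adjoint_symmetric[OF A that x(1)] by (rule tendsto_cinner_right[OF Ax])
    qed
    have "v \<in> ?D" "op_app A v = l + a *\<^sub>R v"
      using self_adjoint_memI[OF A adj] by auto
    then show "l \<in> B ` ?D"
      by (intro image_eqI[of _ _ v]) (auto simp: B_def)
  qed
  have surj: "B ` ?D = UNIV"
  proof -
    have "z \<in> B ` ?D" for z
    proof -
      obtain m where m: "m \<in> B ` ?D" "\<And>w. w \<in> B ` ?D \<Longrightarrow> inner w (z - m) = 0"
        using orthogonal_projection_exists[OF sub cl] by blast
      \<comment> \<open>A vector orthogonal to the range of \<open>B\<close> is in the kernel of the adjoint of \<open>B\<close>, which is \<open>B\<close>.\<close>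
      define v where "v = z - m"
      have orth: "cinner (B w) v = 0" if w: "w \<in> ?D" for w
      proof -
        have "inner (B w) v = 0" "inner (B (\<i> *\<^sub>C w)) v = 0"
          unfolding v_def using m(2) w D_scaleC by auto
        then have "Re (cinner (B w) v) = 0" "Re (\<i> * cinner (B w) v) = 0"
          using B_scaleC[OF w, of \<i>] by (auto simp: Re_cinner simp flip: cinner_scaleC_left)
        then show ?thesis
          by (simp add: complex_eq_iff)
      qed
      have adj: "cinner (op_app A w) v = cinner w (a *\<^sub>R v)" if "w \<in> ?D" for w
        using orth[OF that] by (simp add: B_def cinner_diff_left cinner_scaleR_left cinner_scaleR_right)
      have "v \<in> ?D" "B v = 0"
        using self_adjoint_memI[OF A adj] by (auto simp: B_def)
      then have "v = 0"
        using B_norm[of v] by simp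
      then show ?thesis
        using m(1) by (simp add: v_def)
    qed
    then show ?thesis
      by auto
  qed
  define R where "R = inv_into ?D B"
  have R_dom: "R z \<in> ?D" and BR: "B (R z) = z" for z
    unfolding R_def using surj by (auto intro: inv_into_into f_inv_into_f)
  have RB: "R (B x) = x" if "x \<in> ?D" for x
    using B_inj[OF R_dom that] BR by simp
  have R_add: "R (x + y) = R x + R y" for x y
    by (rule B_inj) (auto simp: R_dom BR D_add B_add)
  have R_scaleC: "R (c *\<^sub>C x) = c *\<^sub>C R x" for c x
    by (rule B_inj) (auto simp: R_dom BR D_scaleC B_scaleC)
  have R_norm: "norm (R x) \<le> norm x" for x
    using B_norm[OF R_dom[of x]] by (simp add: BR)
  show ?thesis
  proof (rule that[of R])
    show "R (c *\<^sub>C x) = c *\<^sub>C R x" for c x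
      by (rule R_scaleC)
    show "hilbert_contraction R"
    proof (rule hilbert_contraction.intro)
      show "bounded_linear R"
        using R_add R_scaleC[of "complex_of_real _"] R_norm
        by (intro bounded_linear_intro[where K = 1]) (auto simp: scaleC_of_real)
      show "inner (R x) y = inner x (R y)" for x y
        using B_sym[OF R_dom[of x] R_dom[of y]] by (simp add: BR flip: Re_cinner)
      show "0 \<le> inner (R x) x" for x
      proof -
        have "0 \<le> (norm (R x))\<^sup>2"
          by simp
        also have "\<dots> \<le> inner (R x) x"
          using B_below[OF R_dom[of x]] by (simp add: BR inner_commute)
        finally show ?thesis .
      qed
      show "inner (R x) x \<le> inner x x" for x
      proof -
        have "inner (R x) x \<le> norm (R x) * norm x"
          by (rule norm_cauchy_schwarz)
        also have "\<dots> \<le> norm x * norm x"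
          by (intro mult_right_mono R_norm) simp
        finally show ?thesis
          by (simp add: power2_norm_eq_inner flip: power2_eq_square)
      qed
    qed
    show "inj R"
      using BR by (intro injI) metis
    show "range R = ?D"
      using R_dom RB by (metis (no_types, lifting) image_subset_iff subsetI subset_antisym rangeI)
    show "op_app A (R z) = z + (k - 1) *\<^sub>R R z" for z
      using BR[of z] by (simp add: B_def a_def algebra_simps)
  qed
qed


section \<open>The spectral theorem for semi-bounded operators\<close>

text \<open>
  Here \<open>R\<close> is a resolvent, and the operator of interest is \<open>R\<inverse> + c\<close>.
\<close>

locale injective_contraction = hilbert_contraction R for R :: "'a::chilbert_space \<Rightarrow> 'a" +
  fixes c :: real
  assumes inj_R: "inj R" and R_scaleC: "R (a *\<^sub>C x) = a *\<^sub>C R x"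
begin

text \<open>
  The spectral mapping that takes \<open>R\<close> to \<open>R\<inverse> + c\<close>. Its value at 0 does not matter, because \<open>{0}\<close> is a null
  set for every \<open>\<mu> x\<close>.
\<close>

definition \<phi> :: "real \<Rightarrow> real" where
  "\<phi> u = 1 / u + c"

text \<open>
  The spectral measure of \<open>R\<inverse> + c\<close>, the image of that of \<open>R\<close>.
\<close>

definition F :: "real set \<Rightarrow> 'a \<Rightarrow> 'a" where
  "F B = E (\<phi> -` B)"

lemma borel_measurable_\<phi> [measurable]: "\<phi> \<in> borel_measurable borel"
  unfolding \<phi>_def by measurable

lemma vimage_\<phi>: "B \<in> sets borel \<Longrightarrow> \<phi> -` B \<in> sets borel"
  using measurable_sets[OF borel_measurable_\<phi>, of B] by simp

lemma E_scaleC: "B \<in> sets borel \<Longrightarrow> E B (a *\<^sub>C x) = a *\<^sub>C E B x"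
  by (rule E_commute) (auto intro: bounded_linear_scaleC simp: R_scaleC)

lemma spectral_measure_F: "spectral_measure F"
  unfolding spectral_measure_def
proof (intro conjI ballI allI impI)
  fix B :: "real set" assume "B \<in> sets borel"
  then have B: "\<phi> -` B \<in> sets borel"
    by (rule vimage_\<phi>)
  show "orth_projection (F B)"
    unfolding orth_projection_def F_def
  proof (intro conjI allI)
    show "cinner (E (\<phi> -` B) x) y = cinner x (E (\<phi> -` B) y)" for x y
      unfolding cinner_eq_iff_inner by (simp add: E_symmetric[OF B] E_scaleC[OF B])
  qed (simp_all add: E_add[OF B] E_scaleC[OF B] E_idem[OF B])
next
  show "F UNIV x = x" for x
    by (simp add: F_def E_UNIV)
next
  fix G :: "nat \<Rightarrow> real set" and x
  assume G: "range G \<subseteq> sets borel" "disjoint_family G"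
  have "(\<lambda>n. E (\<phi> -` G n) x) sums E (\<Union>n. \<phi> -` G n) x"
    using G by (intro E_sums) (auto intro!: vimage_\<phi> simp: disjoint_family_on_def)
  then show "(\<lambda>n. F (G n) x) sums F (\<Union>n. G n) x"
    by (simp add: F_def vimage_UN)
qed

sublocale F: projection_valued_measure F
  by (rule projection_valued_measure.intro) (rule spectral_measure_F)

lemma finite_measure_\<mu>: "finite_measure (\<mu> x)"
  using unit_measure_\<mu>[of x] by (simp add: unit_measure_def)

lemma measurable_\<mu>: "f \<in> borel_measurable borel \<Longrightarrow> f \<in> borel_measurable (\<mu> x)"
  using measurable_cong_sets[OF sets_\<mu>[of x] refl] by blast

lemma scalar_measure_F: "scalar_measure F x = distr (\<mu> x) borel \<phi>"
proof (rule measure_eqI)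
  fix B assume "B \<in> sets (scalar_measure F x)"
  then have B: "B \<in> sets borel"
    by simp
  have "emeasure (scalar_measure F x) B = ennreal (measure (\<mu> x) (\<phi> -` B))"
    by (simp add: F.emeasure_scalar_measure[OF B] F_def norm_E[OF vimage_\<phi>[OF B]])
  also have "\<dots> = emeasure (distr (\<mu> x) borel \<phi>) B"
    using B finite_measure.emeasure_eq_measure[OF finite_measure_\<mu>]
    by (simp add: emeasure_distr[OF measurable_\<mu>] space_\<mu>)
  finally show "emeasure (scalar_measure F x) B = emeasure (distr (\<mu> x) borel \<phi>) B" .
qed simp

lemma nn_integral_scalar_measure_F:
  assumes "g \<in> borel_measurable borel"
  shows "(\<integral>\<^sup>+t. g t \<partial>scalar_measure F x) = (\<integral>\<^sup>+u. g (\<phi> u) \<partial>\<mu> x)"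
  unfolding scalar_measure_F using assms by (intro nn_integral_distr measurable_\<mu>) auto

lemma \<mu>_R: "\<mu> (R z) = density (\<mu> z) (\<lambda>u. ennreal (u\<^sup>2))"
proof (rule measure_eqI)
  have meas: "(\<lambda>u. ennreal (u\<^sup>2)) \<in> borel_measurable (\<mu> z)"
    by (rule measurable_\<mu>) measurable
  fix B assume "B \<in> sets (\<mu> (R z))"
  then have B: "B \<in> sets borel"
    by (simp add: sets_\<mu>)
  have "emeasure (\<mu> (R z)) B = ennreal (\<integral>u. (u * indicator B u)\<^sup>2 \<partial>\<mu> z)"
    by (simp add: finite_measure.emeasure_eq_measure[OF finite_measure_\<mu>] measure_\<mu>_R[OF B])
  also have "\<dots> = (\<integral>\<^sup>+u. ennreal ((u * indicator B u)\<^sup>2) \<partial>\<mu> z)"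
    by (intro nn_integral_eq_integral[symmetric] integrable_\<mu> bounded_borel_intros B) auto
  also have "\<dots> = (\<integral>\<^sup>+u. ennreal (u\<^sup>2) * indicator B u \<partial>\<mu> z)"
    by (intro nn_integral_cong) (auto simp: indicator_def)
  also have "\<dots> = emeasure (density (\<mu> z) (\<lambda>u. ennreal (u\<^sup>2))) B"
    using B by (intro emeasure_density[symmetric] meas) (simp add: sets_\<mu>)
  finally show "emeasure (\<mu> (R z)) B = emeasure (density (\<mu> z) (\<lambda>u. ennreal (u\<^sup>2))) B" .
qed (simp add: sets_\<mu>)

lemma AE_nonzero: "AE u in \<mu> x. u \<noteq> 0"
proof (rule AE_I)
  show "emeasure (\<mu> x) {0} = 0"
    by (simp add: finite_measure.emeasure_eq_measure[OF finite_measure_\<mu>] measure_\<mu>_0[OF inj_R])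
qed (auto simp: sets_\<mu>)

text \<open>
  The integral \<open>\<integral> \<sigma> dF\<close> of a real simple function.
\<close>

abbreviation F_simple :: "(real \<Rightarrow> real) \<Rightarrow> 'a \<Rightarrow> 'a" where
  "F_simple \<sigma> \<equiv> simple_spectral_integral F (\<lambda>t. complex_of_real (\<sigma> t))"

text \<open>
  The squared distance from \<open>\<sigma>\<close> to the identity function in \<open>L\<^sup>2\<close> of the scalar measure of a vector.
\<close>

abbreviation sq_error :: "(real \<Rightarrow> real) \<Rightarrow> 'a \<Rightarrow> ennreal" where
  "sq_error \<sigma> \<equiv> F.sq_integral (\<lambda>t. complex_of_real t - complex_of_real (\<sigma> t))"

lemma F_simple_eq:
  assumes "simple_function borel \<sigma>"
  shows "F_simple \<sigma> x = (\<Sum>v\<in>range \<sigma>. v *\<^sub>R E ((\<lambda>u. \<sigma> (\<phi> u)) -` {v}) x)"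
proof -
  have "(\<lambda>u. \<sigma> (\<phi> u)) -` {v} = \<phi> -` (\<sigma> -` {v})" for v
    by auto
  then show ?thesis
    by (simp add: F.simple_spectral_integral_compose[OF assms] F_def scaleC_of_real)
qed

lemma represents_F_simple:
  assumes "simple_function borel \<sigma>"
  shows "represents (\<lambda>u. \<sigma> (\<phi> u)) x (F_simple \<sigma> x)" and "bounded_borel (\<lambda>u. \<sigma> (\<phi> u))"
proof -
  have [measurable]: "\<sigma> \<in> borel_measurable borel"
    using assms by (rule borel_measurable_simple_function)
  have "finite (range \<sigma>)" "(\<lambda>u. \<sigma> (\<phi> u)) \<in> borel_measurable borel"
    using simple_functionD[OF assms] by auto
  then show "represents (\<lambda>u. \<sigma> (\<phi> u)) x (F_simple \<sigma> x)" "bounded_borel (\<lambda>u. \<sigma> (\<phi> u))"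
    unfolding F_simple_eq[OF assms] by (auto intro!: represents_simple)
qed

lemma F_simple_R:
  assumes "simple_function borel \<sigma>"
  shows "F_simple \<sigma> (R z) = R (F_simple \<sigma> z)"
proof -
  have "(\<lambda>u. \<sigma> (\<phi> u)) -` {v} \<in> sets borel" for v
  proof -
    have "(\<lambda>u. \<sigma> (\<phi> u)) -` {v} = \<phi> -` (\<sigma> -` {v})"
      by auto
    then show ?thesis
      using simple_functionD[OF assms] by (auto intro: vimage_\<phi>)
  qed
  then show ?thesis
    by (simp add: F_simple_eq[OF assms] E_R R.sum R.scaleR)
qed

text \<open>
  With the weight \<open>u\<^sup>2\<close> the unbounded function \<open>\<phi>\<close> becomes harmless: for \<open>u \<noteq> 0\<close>, hence almost everywhere,
  \<open>u (\<phi> u - \<sigma> (\<phi> u)) = 1 + c u - u \<sigma> (\<phi> u)\<close>, and the right-hand side is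
  bounded on \<open>[0, 1]\<close>, so the isometry for \<open>R\<close> computes the integral.
\<close>

lemma weighted_sq_error:
  assumes "simple_function borel \<sigma>"
  shows "(\<integral>\<^sup>+u. ennreal (u\<^sup>2) * ennreal ((cmod (complex_of_real (\<phi> u) - complex_of_real (\<sigma> (\<phi> u))))\<^sup>2) \<partial>\<mu> x)
    = ennreal ((norm (x + c *\<^sub>R R x - R (F_simple \<sigma> x)))\<^sup>2)"
proof -
  let ?g = "\<lambda>u. (1 + c * (u * 1)) + (-1) * (u * \<sigma> (\<phi> u))"
  note rep = represents_F_simple(1)[OF assms, of x] represents_F_simple(2)[OF assms]
  have one: "represents (\<lambda>u. 1) x x"
    using represents_const[of 1 x] by simp
  have g: "bounded_borel ?g"
    by (intro bounded_borel_intros rep)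
  have "represents ?g x ((x + c *\<^sub>R R x) + (-1) *\<^sub>R R (F_simple \<sigma> x))"
    by (intro represents_add represents_cmult represents_mult_id one rep bounded_borel_intros)
  from represents_inner_norm(2)[OF g this]
  have norm: "(norm (x + c *\<^sub>R R x - R (F_simple \<sigma> x)))\<^sup>2 = (\<integral>u. (?g u)\<^sup>2 \<partial>\<mu> x)"
    by simp
  have "(\<integral>\<^sup>+u. ennreal (u\<^sup>2) * ennreal ((cmod (complex_of_real (\<phi> u) - complex_of_real (\<sigma> (\<phi> u))))\<^sup>2) \<partial>\<mu> x)
      = (\<integral>\<^sup>+u. ennreal ((?g u)\<^sup>2) \<partial>\<mu> x)"
  proof (rule nn_integral_cong_AE)
    show "AE u in \<mu> x. ennreal (u\<^sup>2) * ennreal ((cmod (complex_of_real (\<phi> u) - complex_of_real (\<sigma> (\<phi> u))))\<^sup>2)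
        = ennreal ((?g u)\<^sup>2)"
      using AE_nonzero
    proof eventually_elim
      fix u :: real assume u: "u \<noteq> 0"
      have "cmod (complex_of_real (\<phi> u) - complex_of_real (\<sigma> (\<phi> u))) = \<bar>\<phi> u - \<sigma> (\<phi> u)\<bar>"
        by (simp flip: of_real_diff)
      then have "ennreal (u\<^sup>2) * ennreal ((cmod (complex_of_real (\<phi> u) - complex_of_real (\<sigma> (\<phi> u))))\<^sup>2)
          = ennreal ((u * (\<phi> u - \<sigma> (\<phi> u)))\<^sup>2)"
        by (simp add: ennreal_mult power_mult_distrib)
      also have "u * (\<phi> u - \<sigma> (\<phi> u)) = ?g u"
        using u by (simp add: \<phi>_def algebra_simps)
      finally show "ennreal (u\<^sup>2) * ennreal ((cmod (complex_of_real (\<phi> u) - complex_of_real (\<sigma> (\<phi> u))))\<^sup>2)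
          = ennreal ((?g u)\<^sup>2)" .
    qed
  qed
  also have "\<dots> = ennreal (\<integral>u. (?g u)\<^sup>2 \<partial>\<mu> x)"
    by (intro nn_integral_eq_integral integrable_\<mu> bounded_borel_power2 g) auto
  finally show ?thesis
    by (simp only: norm)
qed

lemma sq_error_eq:
  assumes "\<sigma> \<in> borel_measurable borel"
  shows "sq_error \<sigma> x = (\<integral>\<^sup>+u. ennreal ((cmod (complex_of_real (\<phi> u) - complex_of_real (\<sigma> (\<phi> u))))\<^sup>2) \<partial>\<mu> x)"
  using assms by (intro nn_integral_scalar_measure_F) measurable

lemma sq_error_R:
  assumes \<sigma>: "simple_function borel \<sigma>"
  shows "sq_error \<sigma> (R z) = ennreal ((norm (z + c *\<^sub>R R z - F_simple \<sigma> (R z)))\<^sup>2)"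
proof -
  have [measurable]: "\<sigma> \<in> borel_measurable borel"
    using \<sigma> by (rule borel_measurable_simple_function)
  have "sq_error \<sigma> (R z)
      = (\<integral>\<^sup>+u. ennreal (u\<^sup>2) * ennreal ((cmod (complex_of_real (\<phi> u) - complex_of_real (\<sigma> (\<phi> u))))\<^sup>2) \<partial>\<mu> z)"
    unfolding sq_error_eq[OF \<open>\<sigma> \<in> borel_measurable borel\<close>] \<mu>_R
    by (intro nn_integral_density measurable_\<mu>) measurable
  then show ?thesis
    by (simp only: weighted_sq_error[OF \<sigma>] F_simple_R[OF \<sigma>])
qed

lemma sq_error_ge:
  assumes \<sigma>: "simple_function borel \<sigma>"
  shows "ennreal ((norm (x + c *\<^sub>R R x - R (F_simple \<sigma> x)))\<^sup>2) \<le> sq_error \<sigma> x"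
  unfolding weighted_sq_error[OF \<sigma>, symmetric] sq_error_eq[OF borel_measurable_simple_function[OF \<sigma>]]
proof (rule nn_integral_mono_AE)
  have "AE u in \<mu> x. u \<in> {0..1}"
    using unit_measure_\<mu>[of x] by (simp add: unit_measure_def)
  then show "AE u in \<mu> x. ennreal (u\<^sup>2) * ennreal ((cmod (complex_of_real (\<phi> u) - complex_of_real (\<sigma> (\<phi> u))))\<^sup>2)
      \<le> ennreal ((cmod (complex_of_real (\<phi> u) - complex_of_real (\<sigma> (\<phi> u))))\<^sup>2)"
  proof eventually_elim
    fix u :: real assume "u \<in> {0..1}"
    then have "ennreal (u\<^sup>2) \<le> 1"
      by (simp add: power_le_one)
    then show "ennreal (u\<^sup>2) * ennreal ((cmod (complex_of_real (\<phi> u) - complex_of_real (\<sigma> (\<phi> u))))\<^sup>2)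
        \<le> ennreal ((cmod (complex_of_real (\<phi> u) - complex_of_real (\<sigma> (\<phi> u))))\<^sup>2)"
      using mult_right_mono[of "ennreal (u\<^sup>2)" 1] by simp
  qed
qed

lemma approximate_identity:
  assumes fin: "F.sq_integral complex_of_real x < \<infinity>"
  obtains \<sigma> :: "nat \<Rightarrow> real \<Rightarrow> real"
  where "\<And>n. simple_function borel (\<sigma> n)" "(\<lambda>n. sq_error (\<sigma> n) x) \<longlonglongrightarrow> 0"
proof -
  have meas: "complex_of_real \<in> borel_measurable borel"
    by measurable
  obtain s where s: "\<And>n. simple_function borel (s n)"
    "\<And>x. F.sq_integral complex_of_real x < \<infinity> \<Longrightarrow> (\<lambda>n. F.sq_integral (\<lambda>t. complex_of_real t - s n t) x) \<longlonglongrightarrow> 0"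
    "\<And>x. F.sq_integral complex_of_real x < \<infinity> \<Longrightarrow> (\<lambda>n. F.sq_integral (s n) x) \<longlonglongrightarrow> F.sq_integral complex_of_real x"
    by (rule F.approximating_simple_functions[OF meas]) blast
  have le: "sq_error (\<lambda>t. Re (s n t)) x \<le> F.sq_integral (\<lambda>t. complex_of_real t - s n t) x" for n
  proof (intro nn_integral_mono ennreal_leI power_mono)
    fix t
    have "cmod (complex_of_real t - complex_of_real (Re (s n t))) = \<bar>Re (complex_of_real t - s n t)\<bar>"
      by (simp flip: of_real_diff)
    also have "\<dots> \<le> cmod (complex_of_real t - s n t)"
      by (rule abs_Re_le_cmod)
    finally show "cmod (complex_of_real t - complex_of_real (Re (s n t))) \<le> cmod (complex_of_real t - s n t)" .
  qed simp
  have "(\<lambda>n. sq_error (\<lambda>t. Re (s n t)) x) \<longlonglongrightarrow> 0"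
    by (rule tendsto_sandwich[OF _ _ tendsto_const s(2)[OF fin]]) (auto simp: le)
  moreover have "simple_function borel (\<lambda>t. Re (s n t))" for n
    by (rule simple_function_compose1[OF s(1)])
  ultimately show ?thesis
    using that[of "\<lambda>n t. Re (s n t)"] by blast
qed

text \<open>
  Together with \<open>mem_range_R\<close> below this identifies the domain of \<open>\<integral> t dF(t)\<close> with the range of \<open>R\<close>.
\<close>

lemma sq_integral_R_finite: "F.sq_integral complex_of_real (R z) < \<infinity>"
proof -
  have "F.sq_integral complex_of_real (R z) = sq_error (\<lambda>t. 0) (R z)"
    by simp
  also have "\<dots> < \<infinity>"
    by (subst sq_error_R) auto
  finally show ?thesis .
qed

lemma has_spectral_integral_R: "has_spectral_integral F complex_of_real (R z) (z + c *\<^sub>R R z)"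
proof -
  obtain \<sigma> :: "nat \<Rightarrow> real \<Rightarrow> real" where \<sigma>: "\<And>n. simple_function borel (\<sigma> n)" "(\<lambda>n. sq_error (\<sigma> n) (R z)) \<longlonglongrightarrow> 0"
    by (rule approximate_identity[OF sq_integral_R_finite]) blast
  have "(\<lambda>n. z + c *\<^sub>R R z - F_simple (\<sigma> n) (R z)) \<longlonglongrightarrow> 0"
    by (rule ennreal_norm_tendsto_zero[OF _ \<sigma>(2)]) (simp add: sq_error_R[OF \<sigma>(1)])
  from tendsto_diff[OF tendsto_const[of "z + c *\<^sub>R R z"] this]
  have "(\<lambda>n. F_simple (\<sigma> n) (R z)) \<longlonglongrightarrow> z + c *\<^sub>R R z"
    by simp
  then show ?thesis
    unfolding has_spectral_integral_def using \<sigma>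
    by (intro exI[of _ "\<lambda>n t. complex_of_real (\<sigma> n t)"] conjI allI simple_function_compose1[OF \<sigma>(1)])
qed

text \<open>
  If the identity function is square integrable for \<open>x\<close> and \<open>y = \<integral> t dF(t) x\<close>, then \<open>x = R (y - c x)\<close>.
\<close>

lemma mem_range_R:
  assumes fin: "F.sq_integral complex_of_real x < \<infinity>"
  shows "x \<in> range R"
proof -
  obtain \<sigma> :: "nat \<Rightarrow> real \<Rightarrow> real" where \<sigma>: "\<And>n. simple_function borel (\<sigma> n)" "(\<lambda>n. sq_error (\<sigma> n) x) \<longlonglongrightarrow> 0"
    by (rule approximate_identity[OF fin]) blast
  have meas: "complex_of_real \<in> borel_measurable borel"
    by measurable
  obtain y where y: "(\<lambda>n. F_simple (\<sigma> n) x) \<longlonglongrightarrow> y"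
    by (rule F.simple_integrals_converge[OF meas simple_function_compose1[OF \<sigma>(1)] \<sigma>(2)]) blast
  have "(\<lambda>n. x + c *\<^sub>R R x - R (F_simple (\<sigma> n) x)) \<longlonglongrightarrow> 0"
    by (rule ennreal_norm_tendsto_zero[OF sq_error_ge[OF \<sigma>(1)] \<sigma>(2)])
  moreover have "(\<lambda>n. x + c *\<^sub>R R x - R (F_simple (\<sigma> n) x)) \<longlonglongrightarrow> x + c *\<^sub>R R x - R y"
    by (intro tendsto_diff tendsto_const R.tendsto y)
  ultimately have "x + c *\<^sub>R R x - R y = 0"
    by (rule LIMSEQ_unique[symmetric])
  then have "x = R (y - c *\<^sub>R x)"
    by (simp add: R.diff R.scaleR algebra_simps)
  then show ?thesis
    by blast
qed

end

text \<open>
  The spectral theorem for a semi-bounded self-adjoint operator and its real translates. The shift \<open>\<gamma>\<close> is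
  unrelated to the lower bound \<open>k\<close>.
\<close>

theorem spectral_theorem_semibounded:
  fixes A :: "'a::chilbert_space unbounded_op"
  assumes A: "self_adjoint A" and k: "op_bounded_below_by A k"
  shows "\<exists>E. spectral_measure E \<and> op_eq (op_shift A \<gamma>) (spectral_integral E complex_of_real)"
proof -
  obtain R where R: "hilbert_contraction R" "inj R" "\<And>a x. R (a *\<^sub>C x) = a *\<^sub>C R x"
    "range R = op_dom A" "\<And>z. op_app A (R z) = z + (k - 1) *\<^sub>R R z"
    by (rule resolvent_exists[OF A k]) blast
  interpret injective_contraction R "k - 1 - \<gamma>"
    using R by (intro injective_contraction.intro injective_contraction_axioms.intro)
  have meas: "complex_of_real \<in> borel_measurable borel"
    by measurable
  have "op_eq (op_shift A \<gamma>) (spectral_integral F complex_of_real)"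
    unfolding op_eq_def
  proof (intro conjI ballI)
    have "op_dom A = {x. F.sq_integral complex_of_real x < \<infinity>}"
      unfolding R(4)[symmetric] using mem_range_R sq_integral_R_finite by blast
    then show "op_dom (op_shift A \<gamma>) = op_dom (spectral_integral F complex_of_real)"
      by (simp only: op_shift_def spectral_integral_def unbounded_op.sel)
    fix x assume "x \<in> op_dom (op_shift A \<gamma>)"
    then obtain z where z: "x = R z"
      using R(4) by (auto simp: op_shift_def)
    have "op_app (spectral_integral F complex_of_real) x = z + (k - 1 - \<gamma>) *\<^sub>R R z"
      unfolding z by (rule F.op_app_eqI[OF meas has_spectral_integral_R])
    also have "\<dots> = op_app (op_shift A \<gamma>) x"
      by (simp add: op_shift_def z R(5) scaleC_of_real algebra_simps)
    finally show "op_app (op_shift A \<gamma>) x = op_app (spectral_integral F complex_of_real) x" ..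
  qed
  with spectral_measure_F show ?thesis
    by blast
qed


section \<open>Closed forms from spectral integrals\<close>

lemma linear_opD:
  assumes "linear_op T"
  shows "csubspace (op_dom T)"
    and "\<And>x y. x \<in> op_dom T \<Longrightarrow> y \<in> op_dom T \<Longrightarrow> op_app T (x + y) = op_app T x + op_app T y"
    and "\<And>a x. x \<in> op_dom T \<Longrightarrow> op_app T (a *\<^sub>C x) = a *\<^sub>C op_app T x"
  using assms by (auto simp: linear_op_def)

context projection_valued_measure
begin

text \<open>
  The form \<open>\<langle>T x, T y\<rangle> + c \<langle>x, y\<rangle>\<close> for \<open>T = \<integral> f dE\<close>. For \<open>c = 1\<close> it is the graph inner product of \<open>T\<close>.
\<close>

definition graph_form :: "(real \<Rightarrow> complex) \<Rightarrow> real \<Rightarrow> 'a form" where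
  "graph_form f c = Form (op_dom (spectral_integral E f))
     (\<lambda>x y. cinner (op_app (spectral_integral E f) x) (op_app (spectral_integral E f) y)
       + complex_of_real c * cinner x y)"

lemma graph_form_self:
  "form_app (graph_form f c) x x
    = complex_of_real ((norm (op_app (spectral_integral E f) x))\<^sup>2 + c * (norm x)\<^sup>2)"
  by (simp add: graph_form_def cinner_self)

theorem semibounded_graph_form:
  assumes f: "f \<in> borel_measurable borel"
  shows "semibounded_form (graph_form f c)"
  unfolding semibounded_form_def
proof
  note T = linear_opD[OF linear_op_spectral_integral[OF f]]
  show "symmetric_form (graph_form f c)"
    unfolding symmetric_form_def
  proof (intro conjI ballI allI)
    show "csubspace (form_dom (graph_form f c))"
      using T(1) by (simp add: graph_form_def)
    fix x y assume "x \<in> form_dom (graph_form f c)" "y \<in> form_dom (graph_form f c)"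
    then have xy: "x \<in> op_dom (spectral_integral E f)" "y \<in> op_dom (spectral_integral E f)"
      by (simp_all add: graph_form_def)
    show "form_app (graph_form f c) (x + y) z = form_app (graph_form f c) x z + form_app (graph_form f c) y z" for z
      by (simp add: graph_form_def T(2) xy cinner_add_left algebra_simps)
    show "form_app (graph_form f c) (a *\<^sub>C x) y = a * form_app (graph_form f c) x y" for a
      by (simp add: graph_form_def T(3) xy cinner_scaleC_left algebra_simps)
    show "form_app (graph_form f c) x y = cnj (form_app (graph_form f c) y x)"
      by (simp add: graph_form_def flip: cinner_commute)
  qed
  show "\<exists>k. \<forall>x\<in>form_dom (graph_form f c). k * Re (cinner x x) \<le> Re (form_app (graph_form f c) x x)"
    by (intro exI[of _ c]) (simp add: graph_form_self cinner_self del: of_real_add)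
qed

theorem closed_graph_form:
  assumes f: "f \<in> borel_measurable borel"
  shows "closed_form (graph_form f c)"
  unfolding closed_form_def
proof (intro allI impI)
  let ?T = "spectral_integral E f"
  fix x :: "nat \<Rightarrow> 'a" and l
  assume dom: "\<forall>n. x n \<in> form_dom (graph_form f c)" and l: "x \<longlonglongrightarrow> l"
    and lim: "((\<lambda>(n, m). form_app (graph_form f c) (x n - x m) (x n - x m)) \<longlongrightarrow> 0) (sequentially \<times>\<^sub>F sequentially)"
  have x: "x n \<in> op_dom ?T" for n
    using dom by (simp add: graph_form_def)
  have "\<exists>N. \<forall>n\<ge>N. \<forall>m\<ge>N. norm (op_app ?T (x n - x m)) \<le> e" if e: "0 < e" for e
  proof -
    have "eventually (\<lambda>p. norm (case p of (n, m) \<Rightarrow> form_app (graph_form f c) (x n - x m) (x n - x m)) < e\<^sup>2 / 2)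
        (sequentially \<times>\<^sub>F sequentially)"
      using tendstoD[OF lim, of "e\<^sup>2 / 2"] e by (simp add: dist_norm)
    then obtain N1 where N1: "\<And>n m. n \<ge> N1 \<Longrightarrow> m \<ge> N1 \<Longrightarrow>
        norm (form_app (graph_form f c) (x n - x m) (x n - x m)) < e\<^sup>2 / 2"
      unfolding eventually_prod_sequentially by auto
    \<comment> \<open>The choice makes \<open>\<bar>c\<bar> * d\<^sup>2\<close> at most \<open>e\<^sup>2 / 2\<close>; the term \<open>c * (norm x)\<^sup>2\<close> may be negative.\<close>
    define d where "d = e / sqrt (2 * (\<bar>c\<bar> + 1))"
    have d: "0 < d" "\<bar>c\<bar> * d\<^sup>2 \<le> e\<^sup>2 / 2"
      using e by (auto simp: d_def power_divide field_simps)
    obtain N2 where N2: "\<And>n m. n \<ge> N2 \<Longrightarrow> m \<ge> N2 \<Longrightarrow> norm (x n - x m) < d"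
      using CauchyD[OF LIMSEQ_imp_Cauchy[OF l] d(1)] by blast
    show ?thesis
    proof (intro exI[of _ "max N1 N2"] allI impI)
      fix n m assume n: "max N1 N2 \<le> n" and m: "max N1 N2 \<le> m"
      let ?a = "(norm (op_app ?T (x n - x m)))\<^sup>2" and ?b = "(norm (x n - x m))\<^sup>2"
      have 1: "\<bar>?a + c * ?b\<bar> < e\<^sup>2 / 2"
        using N1[of n m] n m by (simp only: graph_form_self norm_of_real max.bounded_iff)
      have "\<bar>c\<bar> * ?b \<le> \<bar>c\<bar> * d\<^sup>2"
        using N2[of n m] n m by (intro mult_left_mono power_mono) auto
      then have 2: "\<bar>c * ?b\<bar> \<le> e\<^sup>2 / 2"
        using d(2) by (simp add: abs_mult)
      have "?a \<le> e\<^sup>2"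
        using 1 2 by linarith
      then show "norm (op_app ?T (x n - x m)) \<le> e"
        using e by (rule power2_le_imp_le[OF _ less_imp_le])
    qed
  qed
  note closed = spectral_integral_closed[OF f x l this]
  have "(\<lambda>n. complex_of_real ((norm (op_app ?T (x n - l)))\<^sup>2 + c * (norm (x n - l))\<^sup>2))
      \<longlonglongrightarrow> complex_of_real ((norm (0 :: 'a))\<^sup>2 + c * (norm (l - l))\<^sup>2)"
    by (intro tendsto_intros closed(2) l)
  then have "(\<lambda>n. form_app (graph_form f c) (x n - l) (x n - l)) \<longlonglongrightarrow> 0"
    by (simp add: graph_form_self)
  with closed(1) show "l \<in> form_dom (graph_form f c) \<and>
      (\<lambda>n. form_app (graph_form f c) (x n - l) (x n - l)) \<longlonglongrightarrow> 0"
    by (simp add: graph_form_def)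
qed

end

theorem proposition1:
  fixes A :: "'a::chilbert_space unbounded_op" and \<gamma> :: real and r :: nat
  assumes "separable_space (euclidean :: 'a topology)"
    and "self_adjoint A"
    and "semibounded_op A"
    and "\<gamma> < op_lower_bound A"
    and "r \<ge> 1"
  shows "closed_form (power_form A \<gamma> r) \<and> semibounded_form (power_form A \<gamma> r)"
proof -
  let ?T = "op_shift A \<gamma>"
  obtain k where "op_bounded_below_by A k"
    using assms(3) by (auto simp: semibounded_op_def)
  then have "spectral_measure (spectral_measure_of ?T)"
    unfolding spectral_measure_of_def
    using someI_ex[OF spectral_theorem_semibounded[OF assms(2)]] by blast
  then interpret projection_valued_measure "spectral_measure_of ?T"
    by (rule projection_valued_measure.intro)
  have "(\<lambda>t. complex_of_real (t powr (real r / 2))) \<in> borel_measurable borel"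
    by measurable
  moreover have "power_form A \<gamma> r = graph_form (\<lambda>t. complex_of_real (t powr (real r / 2))) \<gamma>"
    by (simp add: power_form_def graph_form_def op_powr_def functional_calculus_def Let_def)
  ultimately show ?thesis
    by (simp add: closed_graph_form semibounded_graph_form)
qed

end
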